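(* Let $z_1,\dots,z_n\in\mathbb{C}$, let $\nu\vdash n$ have at most $d$ parts, and let $m\ge d+\nu_1$. Let $E\subseteq M^\nu$ be an eigenspace of $\mathcal{B}_\nu(z_1,\dots,z_n)$, with corresponding point $V_E\in\mathcal{X}^\nu\subseteq\mathrm{Gr}(d,m)$, and let $J=(j_1,\dots,j_d):=(\nu_d+1,\dots,\nu_1+d)\in\binom{[m]}{d}$. For $i\in[d]$, define $$f_i(u):=\frac{f^\nu}{n!}\sum_{k=1}^{j_i}\beta_{(J-j_i)+k,E}\,\frac{u^{k-1}}{(k-1)!}.$$ Then $(f_1,\dots,f_d)$ is the unique basis for $V_E$ such that for all $i\in[d]$ and $k\in J\setminus\{j_i\}$, we have $$f_i(u)=\frac{u^{j_i-1}}{(j_i-1)!}+\text{lower-degree terms}\qquad\text{and}\qquad[u^{k-1}]f_i(u)=0.$$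
   Context: $[n]=\{1,\dots,n\}$; $M^\lambda$ is the Specht module of $\mathfrak{S}_{|\lambda|}$ attached to the partition $\lambda$, with character $\chi^\lambda$; $f^\nu$ (superscript a partition) is the number of standard Young tableaux of shape $\nu$. For $X\subseteq[n]$, $\mathfrak{S}_X\subseteq\mathfrak{S}_n$ is the group of permutations of $X$, and for $|X|=|\lambda|$, $\chi^\lambda$ is regarded as a function on $\mathfrak{S}_X\cong\mathfrak{S}_{|X|}$. Put $\beta^\lambda(t):=\sum_{X\subseteq[n],|X|=|\lambda|}\sum_{\sigma\in\mathfrak{S}_X}\chi^\lambda(\sigma)\sigma\prod_{i\in[n]\setminus X}(z_i+t)\in\mathbb{C}[\mathfrak{S}_n]$ and $\beta^\lambda:=\beta^\lambda(0)$. The Bethe algebra $\mathcal{B}_n(z_1,\dots,z_n)$ is the (commutative) subalgebra of $\mathbb{C}[\mathfrak{S}_n]$ generated by all $\beta^{1^k}(t)$, $k\ge0$, $t\in\mathbb{C}$; it contains all $\beta^\lambda$. $\mathcal{B}_\nu(z_1,\dots,z_n)\subseteq\mathrm{End}(M^\nu)$ is the image of its action on $M^\nu$. An eigenspace $E\subseteq M^\nu$ is a maximal (nonzero) subspace on which every element of $\mathcal{B}_\nu(z_1,\dots,z_n)$ acts as a scalar; $\beta^\lambda_E$ is the scalar by which $\beta^\lambda$ acts on $E$. $\mathrm{Gr}(d,m)$ is the Grassmannian of $d$-dimensional subspaces of $\mathbb{C}^m$, identified with the polynomials of degree at most $m-1$ via $(a_1,\dots,a_m)\leftrightarrow\sum_j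 a_j\frac{u^{j-1}}{(j-1)!}$. $\mathcal{X}^\nu$ is the set of $d$-dimensional subspaces having a basis $(h_1,\dots,h_d)$ with $\deg h_i=\nu_i+d-i$. Plücker coordinates ($d\times d$ minors $\Delta_I$, $I=\{i_1<\dots<i_d\}\in\binom{[m]}{d}$) are indexed by partitions via $\Delta^\lambda=\Delta_I$ with $\lambda=(i_d-d,\dots,i_2-2,i_1-1)$. $V_E\in\mathcal{X}^\nu$ is the point whose Plücker coordinates are $\Delta^\lambda=\beta^\lambda_E$ for $\lambda\subseteq(m-d)^d$ (such a point exists). Write $\beta_{I,E}:=\beta^\lambda_E$ for $I=(i_1<\dots<i_d)\in\binom{[m]}{d}$, where $\lambda=(i_d-d,\dots,i_2-2,i_1-1)$, and extend to $I\in[m]^d$ by the alternating property: $\beta_{(i_{\sigma(1)},\dots,i_{\sigma(d)}),E}=\mathrm{sgn}(\sigma)\beta_{(i_1,\dots,i_d),E}$, and $\beta_{I,E}=0$ if the entries of $I$ are not distinct. For $j=j_s\in J$ and $k\in[m]$, $\beta_{(J-j_s)+k,E}:=(-1)^{d-s}\beta_{(j_1,\dots,\widehat{j_s},\dots,j_d,k),E}$ (hat denotes omission). $[u^{k-1}]$ extracts the coefficient of $u^{k-1}$. *)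

theory Defs
  imports
    Complex_Main
    "HOL-Library.FuncSet"
    "HOL-Library.Function_Algebras"
    "HOL-Combinatorics.Permutations"
    "HOL-Computational_Algebra.Polynomial"
    "Jordan_Normal_Form.Determinant"
begin

text \<open>All the indexing is 1-based: \<open>z\<close> is used at \<open>1, \<dots>, n\<close>, the parts of a partition are
  \<open>\<nu> 1 \<ge> \<nu> 2 \<ge> \<dots>\<close>, and a \<open>d\<close>-tuple is a function used at \<open>1, \<dots>, d\<close>.\<close>

subsection \<open>The complex vector spaces of functions and of polynomials\<close>

definition cscale :: "complex \<Rightarrow> ('a \<Rightarrow> complex) \<Rightarrow> 'a \<Rightarrow> complex" where
  "cscale c v = (\<lambda>x. c * v x)"

global_interpretation cfun: vector_space "cscale :: complex \<Rightarrow> ('a \<Rightarrow> complex) \<Rightarrow> 'a \<Rightarrow> complex"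
  by unfold_locales (auto simp: cscale_def fun_eq_iff algebra_simps)

global_interpretation cpoly: vector_space "smult :: complex \<Rightarrow> complex poly \<Rightarrow> complex poly"
  by unfold_locales (auto simp: smult_add_right smult_add_left)

text \<open>The trace of an endomorphism \<open>T\<close> of a finite-dimensional subspace \<open>M\<close>, computed in an
  arbitrary basis of \<open>M\<close>.\<close>

definition trace_on :: "('a \<Rightarrow> complex) set \<Rightarrow> (('a \<Rightarrow> complex) \<Rightarrow> 'a \<Rightarrow> complex) \<Rightarrow> complex" where
  "trace_on M T =
     (let B = (SOME B. cfun.independent B \<and> cfun.span B = M)
      in \<Sum>b\<in>B. cfun.representation B (T b) b)"


subsection \<open>Partitions and tableaux\<close>

definition diagram :: "(nat \<Rightarrow> nat) \<Rightarrow> (nat \<times> nat) set" where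
  "diagram \<mu> = {(i, j). 1 \<le> i \<and> 1 \<le> j \<and> j \<le> \<mu> i}"

definition psize :: "(nat \<Rightarrow> nat) \<Rightarrow> nat" where
  "psize \<mu> = card (diagram \<mu>)"

text \<open>The argument \<open>0\<close> is not an index of a part; the value there is normalised to \<open>0\<close> so that
  distinct functions represent distinct partitions.\<close>

definition is_partition :: "(nat \<Rightarrow> nat) \<Rightarrow> bool" where
  "is_partition \<mu> \<longleftrightarrow> \<mu> 0 = 0 \<and> (\<forall>i\<ge>1. \<mu> (Suc i) \<le> \<mu> i) \<and> finite {i. \<mu> i \<noteq> 0}"

definition column_partition :: "nat \<Rightarrow> nat \<Rightarrow> nat" where
  "column_partition k i = (if 1 \<le> i \<and> i \<le> k then 1 else 0)"

text \<open>Tableaux of shape \<open>\<mu>\<close>, filled bijectively with the elements of \<open>X\<close>.\<close>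

definition tableaux :: "(nat \<Rightarrow> nat) \<Rightarrow> nat set \<Rightarrow> (nat \<times> nat \<Rightarrow> nat) set" where
  "tableaux \<mu> X = {t \<in> extensional (diagram \<mu>). bij_betw t (diagram \<mu>) X}"

definition standard_tableaux :: "(nat \<Rightarrow> nat) \<Rightarrow> (nat \<times> nat \<Rightarrow> nat) set" where
  "standard_tableaux \<mu> = {t \<in> tableaux \<mu> {1..psize \<mu>}.
     (\<forall>i j j'. (i, j) \<in> diagram \<mu> \<and> (i, j') \<in> diagram \<mu> \<and> j < j' \<longrightarrow> t (i, j) < t (i, j')) \<and>
     (\<forall>i i' j. (i, j) \<in> diagram \<mu> \<and> (i', j) \<in> diagram \<mu> \<and> i < i' \<longrightarrow> t (i, j) < t (i', j))}"

definition num_SYT :: "(nat \<Rightarrow> nat) \<Rightarrow> nat" where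
  "num_SYT \<mu> = card (standard_tableaux \<mu>)"


subsection \<open>Specht modules\<close>

text \<open>The tabloid of \<open>t\<close> is the sequence of its row sets, and the permutation module on tabloids
  consists of functions on such sequences. The polytabloid of \<open>t\<close> is
  \<open>\<Sum>\<pi>. sign \<pi> \<cdot> tabloid (\<pi> \<circ> t)\<close>, over the column stabilizer of \<open>t\<close>.\<close>

definition tabloid :: "(nat \<Rightarrow> nat) \<Rightarrow> (nat \<times> nat \<Rightarrow> nat) \<Rightarrow> nat \<Rightarrow> nat set" where
  "tabloid \<mu> t = (\<lambda>i. t ` {c \<in> diagram \<mu>. fst c = i})"

definition column_stabilizer ::
  "nat set \<Rightarrow> (nat \<Rightarrow> nat) \<Rightarrow> (nat \<times> nat \<Rightarrow> nat) \<Rightarrow> (nat \<Rightarrow> nat) set" where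
  "column_stabilizer X \<mu> t = {\<pi>. \<pi> permutes X \<and>
     (\<forall>j. \<pi> ` t ` {c \<in> diagram \<mu>. snd c = j} = t ` {c \<in> diagram \<mu>. snd c = j})}"

definition polytabloid ::
  "nat set \<Rightarrow> (nat \<Rightarrow> nat) \<Rightarrow> (nat \<times> nat \<Rightarrow> nat) \<Rightarrow> (nat \<Rightarrow> nat set) \<Rightarrow> complex" where
  "polytabloid X \<mu> t = (\<lambda>x. \<Sum>\<pi>\<in>column_stabilizer X \<mu> t.
     of_int (sign \<pi>) * (if tabloid \<mu> (\<pi> \<circ> t) = x then 1 else 0))"

text \<open>The Specht module of the symmetric group on a finite set \<open>X\<close> with \<open>|X| = |\<mu>|\<close>. Filling the
  tableaux with the elements of \<open>X\<close> directly gives the Specht module of \<open>S\<^bsub>|X|\<^esub>\<close> transported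
  along any bijection of \<open>X\<close> with \<open>{1..|X|}\<close>.\<close>

definition specht :: "nat set \<Rightarrow> (nat \<Rightarrow> nat) \<Rightarrow> ((nat \<Rightarrow> nat set) \<Rightarrow> complex) set" where
  "specht X \<mu> = cfun.span (polytabloid X \<mu> ` tableaux \<mu> X)"

text \<open>The linear extension of \<open>\<sigma> \<cdot> tabloid \<mu> t = tabloid \<mu> (\<sigma> \<circ> t)\<close>.\<close>

definition perm_act ::
  "(nat \<Rightarrow> nat) \<Rightarrow> ((nat \<Rightarrow> nat set) \<Rightarrow> complex) \<Rightarrow> (nat \<Rightarrow> nat set) \<Rightarrow> complex" where
  "perm_act \<sigma> v = (\<lambda>x. v (\<lambda>i. Hilbert_Choice.inv \<sigma> ` x i))"

definition specht_char :: "nat set \<Rightarrow> (nat \<Rightarrow> nat) \<Rightarrow> (nat \<Rightarrow> nat) \<Rightarrow> complex" where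
  "specht_char X \<mu> \<sigma> = trace_on (specht X \<mu>) (perm_act \<sigma>)"


subsection \<open>The group algebra and the Bethe algebra\<close>

text \<open>An element of the group algebra of the permutations of \<open>{1..n}\<close> is its coefficient function
  (zero off the permutations of \<open>{1..n}\<close>).\<close>

type_synonym galg = "(nat \<Rightarrow> nat) \<Rightarrow> complex"

definition galg_one :: galg where
  "galg_one = (\<lambda>\<sigma>. if \<sigma> = id then 1 else 0)"

definition galg_mult :: "nat \<Rightarrow> galg \<Rightarrow> galg \<Rightarrow> galg" where
  "galg_mult n a b = (\<lambda>\<sigma>. \<Sum>\<tau> | \<tau> permutes {1..n}. a \<tau> * b (Hilbert_Choice.inv \<tau> \<circ> \<sigma>))"

definition galg_act ::
  "nat \<Rightarrow> galg \<Rightarrow> ((nat \<Rightarrow> nat set) \<Rightarrow> complex) \<Rightarrow> (nat \<Rightarrow> nat set) \<Rightarrow> complex" where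
  "galg_act n a v = (\<lambda>x. \<Sum>\<sigma> | \<sigma> permutes {1..n}. a \<sigma> * perm_act \<sigma> v x)"

text \<open>\<open>\<beta>\<^sup>\<mu>(t)\<close>; the coefficient of \<open>\<sigma>\<close> collects those \<open>X\<close> for which \<open>\<sigma>\<close> is a permutation of \<open>X\<close>.\<close>

definition beta :: "nat \<Rightarrow> (nat \<Rightarrow> complex) \<Rightarrow> (nat \<Rightarrow> nat) \<Rightarrow> complex \<Rightarrow> galg" where
  "beta n z \<mu> t = (\<lambda>\<sigma>. \<Sum>X | X \<subseteq> {1..n} \<and> card X = psize \<mu> \<and> \<sigma> permutes X.
     specht_char X \<mu> \<sigma> * (\<Prod>i\<in>{1..n} - X. (z i + t)))"

inductive_set bethe :: "nat \<Rightarrow> (nat \<Rightarrow> complex) \<Rightarrow> galg set"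
  for n :: nat and z :: "nat \<Rightarrow> complex" where
  gen: "beta n z (column_partition k) t \<in> bethe n z"
| one: "galg_one \<in> bethe n z"
| add: "a \<in> bethe n z \<Longrightarrow> b \<in> bethe n z \<Longrightarrow> a + b \<in> bethe n z"
| scale: "a \<in> bethe n z \<Longrightarrow> cscale c a \<in> bethe n z"
| mult: "a \<in> bethe n z \<Longrightarrow> b \<in> bethe n z \<Longrightarrow> galg_mult n a b \<in> bethe n z"

definition bethe_image :: "nat \<Rightarrow> (nat \<Rightarrow> complex) \<Rightarrow> (nat \<Rightarrow> nat) \<Rightarrow>
    (((nat \<Rightarrow> nat set) \<Rightarrow> complex) \<Rightarrow> (nat \<Rightarrow> nat set) \<Rightarrow> complex) set" where
  "bethe_image n z \<nu> = (\<lambda>a. restrict (galg_act n a) (specht {1..n} \<nu>)) ` bethe n z"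

definition acts_by_scalars ::
  "(('a \<Rightarrow> complex) \<Rightarrow> 'a \<Rightarrow> complex) set \<Rightarrow> ('a \<Rightarrow> complex) set \<Rightarrow> bool" where
  "acts_by_scalars \<A> E \<longleftrightarrow> (\<forall>T\<in>\<A>. \<exists>c. \<forall>v\<in>E. T v = cscale c v)"

definition is_eigenspace ::
  "('a \<Rightarrow> complex) set \<Rightarrow> (('a \<Rightarrow> complex) \<Rightarrow> 'a \<Rightarrow> complex) set \<Rightarrow> ('a \<Rightarrow> complex) set \<Rightarrow> bool" where
  "is_eigenspace M \<A> E \<longleftrightarrow>
     cfun.subspace E \<and> E \<subseteq> M \<and> E \<noteq> {0} \<and> acts_by_scalars \<A> E \<and>
     (\<forall>E'. cfun.subspace E' \<and> E' \<subseteq> M \<and> acts_by_scalars \<A> E' \<and> E \<subseteq> E' \<longrightarrow> E' = E)"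

definition beta_E ::
  "nat \<Rightarrow> (nat \<Rightarrow> complex) \<Rightarrow> ((nat \<Rightarrow> nat set) \<Rightarrow> complex) set \<Rightarrow> (nat \<Rightarrow> nat) \<Rightarrow> complex" where
  "beta_E n z E \<mu> = (THE c. \<forall>v\<in>E. galg_act n (beta n z \<mu> 0) v = cscale c v)"


subsection \<open>Indexing by tuples\<close>

text \<open>The partition \<open>(i\<^sub>d - d, \<dots>, i\<^sub>2 - 2, i\<^sub>1 - 1)\<close> of an increasing tuple \<open>I = (i\<^sub>1 < \<dots> < i\<^sub>d)\<close> of
  positive integers (so the subtraction does not truncate).\<close>

definition partition_of :: "nat \<Rightarrow> (nat \<Rightarrow> nat) \<Rightarrow> nat \<Rightarrow> nat" where
  "partition_of d I r = (if 1 \<le> r \<and> r \<le> d then I (d + 1 - r) - (d + 1 - r) else 0)"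

text \<open>\<open>\<beta>\<^bsub>I,E\<^esub>\<close> for an arbitrary tuple \<open>I\<close> of positive integers. If \<open>I \<circ> \<sigma>\<close> is increasing, then \<open>I\<close> is
  the rearrangement of \<open>I \<circ> \<sigma>\<close> by \<open>inv \<sigma>\<close>, which has the same sign as \<open>\<sigma>\<close>.\<close>

definition beta_tuple ::
  "nat \<Rightarrow> (nat \<Rightarrow> complex) \<Rightarrow> ((nat \<Rightarrow> nat set) \<Rightarrow> complex) set \<Rightarrow> nat \<Rightarrow> (nat \<Rightarrow> nat) \<Rightarrow> complex" where
  "beta_tuple n z E d I =
     (if inj_on I {1..d} then
        (let \<sigma> = (THE \<sigma>. \<sigma> permutes {1..d} \<and> strict_mono_on {1..d} (I \<circ> \<sigma>))
         in of_int (sign \<sigma>) * beta_E n z E (partition_of d (I \<circ> \<sigma>)))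
      else 0)"

text \<open>\<open>(j\<^sub>1, \<dots>, j\<^sub>d)\<close> with \<open>j\<^sub>s\<close> omitted and \<open>k\<close> appended.\<close>

definition replace_last :: "nat \<Rightarrow> (nat \<Rightarrow> nat) \<Rightarrow> nat \<Rightarrow> nat \<Rightarrow> nat \<Rightarrow> nat" where
  "replace_last d J s k = (\<lambda>r. if r < s then J r else if r < d then J (r + 1) else k)"

text \<open>\<open>\<beta>\<^bsub>(J - j\<^sub>s) + k, E\<^esub>\<close>\<close>

definition beta_replace :: "nat \<Rightarrow> (nat \<Rightarrow> complex) \<Rightarrow> ((nat \<Rightarrow> nat set) \<Rightarrow> complex) set \<Rightarrow>
    nat \<Rightarrow> (nat \<Rightarrow> nat) \<Rightarrow> nat \<Rightarrow> nat \<Rightarrow> complex" where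
  "beta_replace n z E d J s k = (- 1) ^ (d - s) * beta_tuple n z E d (replace_last d J s k)"


subsection \<open>The Grassmannian\<close>

definition poly_space :: "nat \<Rightarrow> complex poly set" where
  "poly_space m = {p. \<forall>k\<ge>m. coeff p k = 0}"

definition Gr :: "nat \<Rightarrow> nat \<Rightarrow> complex poly set set" where
  "Gr d m = {V. cpoly.subspace V \<and> V \<subseteq> poly_space m \<and> cpoly.dim V = d}"

definition is_basis :: "nat \<Rightarrow> (nat \<Rightarrow> complex poly) \<Rightarrow> complex poly set \<Rightarrow> bool" where
  "is_basis d h V \<longleftrightarrow>
     inj_on h {1..d} \<and> cpoly.independent (h ` {1..d}) \<and> cpoly.span (h ` {1..d}) = V"

text \<open>\<open>\<X>\<^sup>\<nu>\<close>\<close>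

definition schubert_cell :: "nat \<Rightarrow> nat \<Rightarrow> (nat \<Rightarrow> nat) \<Rightarrow> complex poly set set" where
  "schubert_cell d m \<nu> =
     {V \<in> Gr d m. \<exists>h. is_basis d h V \<and> (\<forall>i\<in>{1..d}. degree (h i) = \<nu> i + d - i)}"

text \<open>The vector \<open>(a\<^sub>1, \<dots>, a\<^sub>m)\<close> corresponds to the polynomial \<open>\<Sum>j. a\<^sub>j u\<^bsup>j - 1\<^esup> / (j - 1)!\<close>.\<close>

definition coord :: "complex poly \<Rightarrow> nat \<Rightarrow> complex" where
  "coord p j = fact (j - 1) * coeff p (j - 1)"

text \<open>The minor in columns \<open>I 1, \<dots>, I d\<close> of the matrix whose rows are \<open>h 1, \<dots>, h d\<close>.\<close>

definition plucker_minor :: "nat \<Rightarrow> (nat \<Rightarrow> complex poly) \<Rightarrow> (nat \<Rightarrow> nat) \<Rightarrow> complex" where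
  "plucker_minor d h I = det (mat d d (\<lambda>(r, s). coord (h (Suc r)) (I (Suc s))))"

text \<open>\<open>P\<close>, a family indexed by partitions, gives the (projective) Pluecker coordinates of \<open>V\<close>. The
  partitions contained in the \<open>d \<times> (m - d)\<close> rectangle are those of the increasing \<open>d\<close>-tuples in
  \<open>{1..m}\<close>.\<close>

definition has_plucker_coords ::
  "nat \<Rightarrow> nat \<Rightarrow> complex poly set \<Rightarrow> ((nat \<Rightarrow> nat) \<Rightarrow> complex) \<Rightarrow> bool" where
  "has_plucker_coords d m V P \<longleftrightarrow>
     (\<exists>h c. is_basis d h V \<and> c \<noteq> 0 \<and>
        (\<forall>I. strict_mono_on {1..d} I \<and> I ` {1..d} \<subseteq> {1..m} \<longrightarrow>
           P (partition_of d I) = c * plucker_minor d h I))"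


subsection \<open>The reduced basis\<close>

text \<open>\<open>J = (\<nu>\<^sub>d + 1, \<dots>, \<nu>\<^sub>1 + d)\<close>\<close>

definition top_tuple :: "nat \<Rightarrow> (nat \<Rightarrow> nat) \<Rightarrow> nat \<Rightarrow> nat" where
  "top_tuple d \<nu> i = \<nu> (d + 1 - i) + i"

definition f_poly :: "nat \<Rightarrow> (nat \<Rightarrow> complex) \<Rightarrow> (nat \<Rightarrow> nat) \<Rightarrow>
    ((nat \<Rightarrow> nat set) \<Rightarrow> complex) set \<Rightarrow> nat \<Rightarrow> nat \<Rightarrow> complex poly" where
  "f_poly n z \<nu> E d i = smult (of_nat (num_SYT \<nu>) / fact n)
     (\<Sum>k = 1..top_tuple d \<nu> i.
        monom (beta_replace n z E d (top_tuple d \<nu>) i k / fact (k - 1)) (k - 1))"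

definition is_reduced :: "nat \<Rightarrow> (nat \<Rightarrow> nat) \<Rightarrow> (nat \<Rightarrow> complex poly) \<Rightarrow> bool" where
  "is_reduced d J h \<longleftrightarrow> (\<forall>i\<in>{1..d}.
     degree (h i) = J i - 1 \<and> lead_coeff (h i) = 1 / fact (J i - 1) \<and>
     (\<forall>k\<in>J ` {1..d} - {J i}. coeff (h i) (k - 1) = 0))"

end

theory Submission
  imports Defs
begin

text \<open>Normalise a basis of \<open>V\<close> to \<open>(g\<^sub>1, \<dots>, g\<^sub>d)\<close> dual to the coordinates \<open>j\<^sub>1, \<dots>, j\<^sub>d\<close>, the degrees
  that occur in \<open>V\<close> (shifted by one). The minor of \<open>g\<close> in the columns \<open>(J - j\<^sub>i) + k\<close> is the \<open>k\<close>-th coordinate of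
  \<open>g\<^sub>i\<close>, and the minor in the columns \<open>J\<close> is \<open>1\<close>, so \<open>\<beta>\<close> of \<open>(J - j\<^sub>i) + k\<close> is \<open>\<beta>\<^sup>\<nu>\<close> times this coordinate and
  everything reduces to \<open>\<beta>\<^sup>\<nu> = n! / f\<^sup>\<nu>\<close> on the Specht module, that is, to
  \<open>\<Sum>\<sigma>. \<chi>\<^sup>\<nu>(\<sigma>) \<sigma> = n! / dim\<close> and \<open>dim = f\<^sup>\<nu>\<close>.

  The first identity is Schur orthogonality. The vectors alternating under the column stabilizer of a tableau
  form a line, so equivariant operators are scalar without any appeal to eigenvalues; all traces
  are computed in the tight frame formed by the orbit of a polytabloid, and the integrality of
  polytabloids replaces complex conjugation. For the second, evaluation at the standard
  tabloids is injective on the module by the Garnir relations, and standard polytabloids are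
  independent by triangularity.\<close>

subsection \<open>Tabloids and polytabloids\<close>

text \<open>The factor in \<open>f_poly\<close> has to be the reciprocal of the coordinate at J, and
  that coordinate does not involve z: as |\<nu>| = n, only the full set contributes to
  \<open>beta\<close>, with an empty product. The alternating functions form a line because such a
  function vanishes at every tabloid with two entries of one column of t in the same row, while
  column permutations reach all other tabloids from the tabloid of t. So a scalar can be read off as
  a single value. The form \<open>bform\<close> is bilinear and thus not definite over the complex
  numbers; on an integer-valued function, however, it gives a sum of squares, and this makes the
  frame constant nonzero. The dimension is caught between two bounds. For the upper one, the Garnir
  relations act as linear equations on values, so they can be verified on one polytabloid at a time,
  and an injectivity argument takes the place of a spanning argument.\<close>

lemma cscale_apply [simp]: "cscale c v x = c * v x"
  by (simp add: cscale_def)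

lemma sum_fun_apply: "(\<Sum>i\<in>A. f i) x = (\<Sum>i\<in>A. f i x)" for f :: "'i \<Rightarrow> 'a \<Rightarrow> complex"
  by (induction A rule: infinite_finite_induct) auto

lemma finite_diagram:
  assumes "is_partition \<mu>"
  shows "finite (diagram \<mu>)"
proof (rule finite_subset)
  show "diagram \<mu> \<subseteq> (SIGMA i:{i. \<mu> i \<noteq> 0}. {1..\<mu> i})"
    by (auto simp: diagram_def)
  show "finite (SIGMA i:{i. \<mu> i \<noteq> 0}. {1..\<mu> i})"
    using assms by (auto simp: is_partition_def)
qed

lemma partition_antimono:
  assumes "is_partition \<mu>" and "1 \<le> i" and "i \<le> k"
  shows "\<mu> k \<le> \<mu> i"
  using assms(3,2)
proof (induction rule: dec_induct)
  case (step m)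
  then have "\<mu> (Suc m) \<le> \<mu> m"
    using assms(1) by (auto simp: is_partition_def)
  with step show ?case by simp
qed simp

lemma permutes_sum_left:
  assumes "\<tau> permutes X"
  shows "(\<Sum>\<sigma> | \<sigma> permutes X. f (\<tau> \<circ> \<sigma>)) = (\<Sum>\<sigma> | \<sigma> permutes X. f \<sigma>)"
  by (rule sum.reindex_bij_witness[where i = "\<lambda>\<sigma>. Hilbert_Choice.inv \<tau> \<circ> \<sigma>" and j = "\<lambda>\<sigma>. \<tau> \<circ> \<sigma>"])
    (use assms in \<open>auto simp: permutes_compose permutes_inv o_assoc permutes_inv_o\<close>)

section \<open>Permutations acting on tabloids and on functions of tabloids\<close>

definition perm_image :: "(nat \<Rightarrow> nat) \<Rightarrow> (nat \<Rightarrow> nat set) \<Rightarrow> nat \<Rightarrow> nat set" where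
  "perm_image h x = (\<lambda>i. h ` x i)"

lemma perm_act_apply: "perm_act \<sigma> v x = v (perm_image (Hilbert_Choice.inv \<sigma>) x)"
  by (simp add: perm_act_def perm_image_def)

lemma perm_image_comp: "perm_image (g \<circ> h) x = perm_image g (perm_image h x)"
  by (auto simp: perm_image_def)

lemma perm_image_id [simp]: "perm_image id x = x"
  by (auto simp: perm_image_def)

lemma perm_image_tabloid: "perm_image h (tabloid \<mu> t) = tabloid \<mu> (h \<circ> t)"
  by (auto simp: perm_image_def tabloid_def image_comp)

lemma perm_act_comp:
  assumes "bij \<sigma>" and "bij \<tau>"
  shows "perm_act (\<sigma> \<circ> \<tau>) v = perm_act \<sigma> (perm_act \<tau> v)"
  using assms by (auto simp: fun_eq_iff perm_act_apply o_inv_distrib perm_image_comp)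

lemma perm_act_id [simp]: "perm_act id v = v"
  by (auto simp: fun_eq_iff perm_act_apply)

lemma perm_act_add: "perm_act \<sigma> (u + v) = perm_act \<sigma> u + perm_act \<sigma> v"
  by (auto simp: fun_eq_iff perm_act_apply)

lemma perm_act_diff: "perm_act \<sigma> (u - v) = perm_act \<sigma> u - perm_act \<sigma> v"
  by (auto simp: fun_eq_iff perm_act_apply)

lemma perm_act_cscale: "perm_act \<sigma> (cscale c v) = cscale c (perm_act \<sigma> v)"
  by (auto simp: fun_eq_iff perm_act_apply)

lemma perm_act_sum: "perm_act \<sigma> (\<Sum>i\<in>A. f i) = (\<Sum>i\<in>A. perm_act \<sigma> (f i))"
  by (auto simp: fun_eq_iff perm_act_apply sum_fun_apply)

lemma tabloid_cong:
  assumes "\<And>c. c \<in> diagram \<mu> \<Longrightarrow> s c = t c"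
  shows "tabloid \<mu> s = tabloid \<mu> t"
  unfolding tabloid_def by (rule ext, rule image_cong) (use assms in auto)

lemma polytabloid_cong:
  assumes "\<And>c. c \<in> diagram \<mu> \<Longrightarrow> s c = t c"
  shows "polytabloid X \<mu> s = polytabloid X \<mu> t"
proof -
  have "s ` {c \<in> diagram \<mu>. snd c = j} = t ` {c \<in> diagram \<mu>. snd c = j}" for j
    by (rule image_cong) (use assms in auto)
  then have "column_stabilizer X \<mu> s = column_stabilizer X \<mu> t"
    by (simp add: column_stabilizer_def)
  moreover have "tabloid \<mu> (\<pi> \<circ> s) = tabloid \<mu> (\<pi> \<circ> t)" for \<pi>
    by (rule tabloid_cong) (use assms in auto)
  ultimately show ?thesis
    by (simp add: polytabloid_def)
qed

locale specht_module =
  fixes X :: "nat set" and \<mu> :: "nat \<Rightarrow> nat"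
  assumes finite_X: "finite X" and part: "is_partition \<mu>" and card_X: "card X = psize \<mu>"
begin

abbreviation "D \<equiv> diagram \<mu>"

abbreviation "M \<equiv> specht X \<mu>"

abbreviation "e \<equiv> polytabloid X \<mu>"

text \<open>Values off the diagram are left free, in contrast to \<open>tableaux\<close>: composing
  with a permutation of \<open>X\<close> need not preserve extensionality, and tabloids and
  polytabloids only see the cells of the diagram.\<close>

definition filling :: "(nat \<times> nat \<Rightarrow> nat) \<Rightarrow> bool" where
  "filling t \<longleftrightarrow> bij_betw t D X"

definition tabloids :: "(nat \<Rightarrow> nat set) set" where
  "tabloids = tabloid \<mu> ` {t. filling t}"

lemma finite_D: "finite D"
  using part by (rule finite_diagram)

lemma tableaux_filling: "t \<in> tableaux \<mu> X \<Longrightarrow> filling t"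
  by (simp add: tableaux_def filling_def)

lemma restrict_filling:
  assumes "filling t"
  shows "restrict t D \<in> tableaux \<mu> X"
proof -
  have "bij_betw (restrict t D) D X = bij_betw t D X"
    by (rule bij_betw_cong) simp
  with assms show ?thesis by (simp add: tableaux_def filling_def)
qed

lemma polytabloid_image: "e ` tableaux \<mu> X = e ` {t. filling t}"
proof (intro equalityI subsetI)
  fix y assume "y \<in> e ` {t. filling t}"
  then obtain t where "filling t" "y = e t" by auto
  moreover have "e (restrict t D) = e t"
    by (rule polytabloid_cong) simp
  ultimately show "y \<in> e ` tableaux \<mu> X"
    using restrict_filling by (metis image_eqI)
qed (use tableaux_filling in auto)

lemma specht_eq_span: "M = cfun.span (e ` {t. filling t})"
  by (simp add: specht_def polytabloid_image)

lemma tabloids_eq: "tabloids = tabloid \<mu> ` tableaux \<mu> X"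
proof (intro equalityI subsetI)
  fix y assume "y \<in> tabloids"
  then obtain t where "filling t" "y = tabloid \<mu> t" by (auto simp: tabloids_def)
  moreover have "tabloid \<mu> (restrict t D) = tabloid \<mu> t"
    by (rule tabloid_cong) simp
  ultimately show "y \<in> tabloid \<mu> ` tableaux \<mu> X"
    using restrict_filling by (metis image_eqI)
qed (use tableaux_filling in \<open>auto simp: tabloids_def\<close>)

lemma finite_tableaux: "finite (tableaux \<mu> X)"
proof (rule finite_subset)
  show "tableaux \<mu> X \<subseteq> D \<rightarrow>\<^sub>E X"
    by (auto simp: tableaux_def PiE_def bij_betw_def)
  show "finite (D \<rightarrow>\<^sub>E X)"
    using finite_D finite_X by (intro finite_PiE) auto
qed

lemma finite_tabloids: "finite tabloids"
  by (simp add: tabloids_eq finite_tableaux)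

lemma ex_filling: "\<exists>t. filling t"
  unfolding filling_def
  by (rule finite_same_card_bij) (use finite_D finite_X card_X in \<open>auto simp: psize_def\<close>)

lemma polytabloid_in_specht: "filling t \<Longrightarrow> e t \<in> M"
  unfolding specht_eq_span by (intro cfun.span_base) auto

lemma finite_spanning: "finite (e ` {t. filling t})"
  by (metis finite_imageI finite_tableaux polytabloid_image)

definition column :: "(nat \<times> nat \<Rightarrow> nat) \<Rightarrow> nat \<Rightarrow> nat set" where
  "column t j = t ` {c \<in> D. snd c = j}"

lemma column_comp: "column (f \<circ> t) j = f ` column t j"
  by (simp add: column_def image_comp)

lemma column_stabilizer_iff:
  "\<pi> \<in> column_stabilizer X \<mu> t \<longleftrightarrow> \<pi> permutes X \<and> (\<forall>j. \<pi> ` column t j = column t j)"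
  by (simp add: column_stabilizer_def column_def)

lemma filling_perm:
  assumes "filling t" and "\<sigma> permutes X"
  shows "filling (\<sigma> \<circ> t)"
  using assms bij_betw_trans permutes_imp_bij unfolding filling_def by blast

lemma filling_rel:
  assumes "filling s" and "filling t"
  obtains \<sigma> where "\<sigma> permutes X" and "\<And>c. c \<in> D \<Longrightarrow> s c = \<sigma> (t c)"
proof -
  define \<sigma> where "\<sigma> = (\<lambda>a. if a \<in> X then s (inv_into D t a) else a)"
  have t: "bij_betw t D X" and s: "bij_betw s D X"
    using assms by (auto simp: filling_def)
  have "bij_betw (s \<circ> inv_into D t) X X"
    using bij_betw_inv_into[OF t] s by (rule bij_betw_trans)
  then have "bij_betw \<sigma> X X"
    by (rule bij_betw_cong[THEN iffD1, rotated]) (simp add: \<sigma>_def)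
  then have "\<sigma> permutes X"
    by (rule bij_imp_permutes) (simp add: \<sigma>_def)
  moreover have "s c = \<sigma> (t c)" if "c \<in> D" for c
    using that t by (auto simp: \<sigma>_def bij_betw_def)
  ultimately show ?thesis by (rule that)
qed

lemma finite_perms: "finite {\<sigma>. \<sigma> permutes X}"
  using finite_X by (rule finite_permutations)

lemma finite_column_stabilizer: "finite (column_stabilizer X \<mu> t)"
  by (rule finite_subset[OF _ finite_perms]) (auto simp: column_stabilizer_def)

lemma permutation_X: "\<sigma> permutes X \<Longrightarrow> permutation \<sigma>"
  using finite_X by (rule permutes_imp_permutation)

lemma conj_column_stabilizer:
  assumes \<sigma>: "\<sigma> permutes X" and \<pi>: "\<pi> \<in> column_stabilizer X \<mu> t"
  shows "\<sigma> \<circ> \<pi> \<circ> Hilbert_Choice.inv \<sigma> \<in> column_stabilizer X \<mu> (\<sigma> \<circ> t)"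
proof -
  have "\<sigma> \<circ> \<pi> \<circ> Hilbert_Choice.inv \<sigma> permutes X"
    using \<sigma> \<pi> by (auto simp: column_stabilizer_iff intro: permutes_compose permutes_inv)
  moreover have "(\<sigma> \<circ> \<pi> \<circ> Hilbert_Choice.inv \<sigma>) ` column (\<sigma> \<circ> t) j = \<sigma> ` \<pi> ` column t j" for j
    using permutes_inverses(2)[OF \<sigma>] by (simp add: column_comp image_image)
  ultimately show ?thesis
    using \<pi> by (simp add: column_stabilizer_iff column_comp)
qed

text \<open>Conjugation by \<open>\<sigma>\<close> carries the column stabilizer of \<open>t\<close>
  to that of \<open>\<sigma> \<circ> t\<close> and preserves signs. Consequently all polytabloids
  lie in one orbit, and each of them generates the module.\<close>

lemma perm_act_polytabloid:
  assumes \<sigma>: "\<sigma> permutes X"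
  shows "perm_act \<sigma> (e t) = e (\<sigma> \<circ> t)"
proof
  fix x
  have b: "bij \<sigma>" using \<sigma> by (rule permutes_bij)
  have shift: "tabloid \<mu> (\<pi> \<circ> t) = perm_image (Hilbert_Choice.inv \<sigma>) x \<longleftrightarrow>
      tabloid \<mu> (\<sigma> \<circ> \<pi> \<circ> Hilbert_Choice.inv \<sigma> \<circ> (\<sigma> \<circ> t)) = x" for \<pi>
  proof -
    have "\<sigma> \<circ> \<pi> \<circ> Hilbert_Choice.inv \<sigma> \<circ> (\<sigma> \<circ> t) = \<sigma> \<circ> (\<pi> \<circ> t)"
      using permutes_inverses(2)[OF \<sigma>] by (auto simp: fun_eq_iff)
    then have "tabloid \<mu> (\<sigma> \<circ> \<pi> \<circ> Hilbert_Choice.inv \<sigma> \<circ> (\<sigma> \<circ> t)) = perm_image \<sigma> (tabloid \<mu> (\<pi> \<circ> t))"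
      by (simp add: perm_image_tabloid)
    then show ?thesis
      by (metis \<sigma> perm_image_comp perm_image_id permutes_inv_o)
  qed
  have sgn: "sign (\<sigma> \<circ> \<pi> \<circ> Hilbert_Choice.inv \<sigma>) = sign \<pi>" if "\<pi> permutes X" for \<pi>
  proof -
    have "sign (\<sigma> \<circ> \<pi> \<circ> Hilbert_Choice.inv \<sigma>) = sign \<sigma> * sign \<pi> * sign \<sigma>"
      using permutation_X[OF that] permutation_X[OF \<sigma>]
      by (simp add: sign_compose sign_inverse permutation_inverse permutation_compose)
    then show ?thesis
      using sign_idempotent[of \<sigma>] by (simp add: mult.commute mult.assoc)
  qed
  show "perm_act \<sigma> (e t) x = e (\<sigma> \<circ> t) x"
    unfolding perm_act_apply polytabloid_def
  proof (rule sum.reindex_bij_witness[where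
        j = "\<lambda>\<pi>. \<sigma> \<circ> \<pi> \<circ> Hilbert_Choice.inv \<sigma>" and
        i = "\<lambda>\<pi>. Hilbert_Choice.inv \<sigma> \<circ> \<pi> \<circ> \<sigma>"])
    fix \<pi> assume "\<pi> \<in> column_stabilizer X \<mu> (\<sigma> \<circ> t)"
    from conj_column_stabilizer[OF permutes_inv[OF \<sigma>] this]
    show "Hilbert_Choice.inv \<sigma> \<circ> \<pi> \<circ> \<sigma> \<in> column_stabilizer X \<mu> t"
      using \<sigma> by (simp add: permutes_inv_inv o_assoc permutes_inv_o)
    show "\<sigma> \<circ> (Hilbert_Choice.inv \<sigma> \<circ> \<pi> \<circ> \<sigma>) \<circ> Hilbert_Choice.inv \<sigma> = \<pi>"
      using permutes_inverses[OF \<sigma>] by (simp add: fun_eq_iff)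
  next
    fix \<pi> assume \<pi>: "\<pi> \<in> column_stabilizer X \<mu> t"
    show "\<sigma> \<circ> \<pi> \<circ> Hilbert_Choice.inv \<sigma> \<in> column_stabilizer X \<mu> (\<sigma> \<circ> t)"
      using \<sigma> \<pi> by (rule conj_column_stabilizer)
    show "Hilbert_Choice.inv \<sigma> \<circ> (\<sigma> \<circ> \<pi> \<circ> Hilbert_Choice.inv \<sigma>) \<circ> \<sigma> = \<pi>"
      using permutes_inverses[OF \<sigma>] by (simp add: fun_eq_iff)
    show "of_int (sign (\<sigma> \<circ> \<pi> \<circ> Hilbert_Choice.inv \<sigma>)) *
        (if tabloid \<mu> (\<sigma> \<circ> \<pi> \<circ> Hilbert_Choice.inv \<sigma> \<circ> (\<sigma> \<circ> t)) = x then 1 else 0) =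
      (of_int (sign \<pi>) * (if tabloid \<mu> (\<pi> \<circ> t) = perm_image (Hilbert_Choice.inv \<sigma>) x then 1 else 0) :: complex)"
      using \<pi> by (simp only: shift sgn column_stabilizer_iff)
  qed
qed

lemma column_stabilizer_perm:
  assumes "\<pi> \<in> column_stabilizer X \<mu> t"
  shows "column_stabilizer X \<mu> (\<pi> \<circ> t) = column_stabilizer X \<mu> t"
  by (rule Set.set_eqI) (use assms in \<open>simp add: column_stabilizer_iff column_comp\<close>)

lemma column_stabilizer_permutes: "\<pi> \<in> column_stabilizer X \<mu> t \<Longrightarrow> \<pi> permutes X"
  by (simp add: column_stabilizer_def)

lemma column_stabilizer_comp:
  "\<pi> \<in> column_stabilizer X \<mu> t \<Longrightarrow> \<rho> \<in> column_stabilizer X \<mu> t \<Longrightarrow> \<rho> \<circ> \<pi> \<in> column_stabilizer X \<mu> t"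
  by (simp add: column_stabilizer_iff permutes_compose) (simp add: image_image[of \<rho> \<pi>, symmetric])

lemma column_stabilizer_inv:
  assumes "\<pi> \<in> column_stabilizer X \<mu> t"
  shows "Hilbert_Choice.inv \<pi> \<in> column_stabilizer X \<mu> t"
proof -
  have p: "\<pi> permutes X" using assms by (rule column_stabilizer_permutes)
  have "Hilbert_Choice.inv \<pi> ` A = A" if "\<pi> ` A = A" for A
    using that p by (metis image_inv_f_f permutes_inj)
  then show ?thesis
    using assms by (auto simp: column_stabilizer_iff permutes_inv)
qed

lemma polytabloid_column_stabilizer:
  assumes \<pi>: "\<pi> \<in> column_stabilizer X \<mu> t"
  shows "e (\<pi> \<circ> t) = cscale (of_int (sign \<pi>)) (e t)"
proof
  fix x
  have p: "\<pi> permutes X" using \<pi> by (rule column_stabilizer_permutes)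
  have sgn: "sign (\<rho> \<circ> \<pi>) * sign \<pi> = sign \<rho>" if "\<rho> \<in> column_stabilizer X \<mu> t" for \<rho>
    using column_stabilizer_permutes[OF that] p
    by (simp add: sign_compose permutation_X mult.assoc sign_idempotent)
  have "e (\<pi> \<circ> t) x = (\<Sum>\<rho>\<in>column_stabilizer X \<mu> t.
      of_int (sign \<rho>) * (if tabloid \<mu> (\<rho> \<circ> \<pi> \<circ> t) = x then 1 else 0))"
    by (simp add: polytabloid_def column_stabilizer_perm[OF \<pi>] o_assoc)
  also have "\<dots> = (\<Sum>\<rho>\<in>column_stabilizer X \<mu> t.
      of_int (sign \<rho>) * of_int (sign \<pi>) * (if tabloid \<mu> (\<rho> \<circ> t) = x then 1 else 0))"
    using \<pi> permutes_inverses[OF p]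
    by (intro sum.reindex_bij_witness[where j = "\<lambda>\<rho>. \<rho> \<circ> \<pi>" and i = "\<lambda>\<rho>. \<rho> \<circ> Hilbert_Choice.inv \<pi>"])
      (auto simp: fun_eq_iff sgn column_stabilizer_comp column_stabilizer_inv
        simp flip: of_int_mult)
  finally show "e (\<pi> \<circ> t) x = cscale (of_int (sign \<pi>)) (e t) x"
    by (simp add: polytabloid_def sum_distrib_left mult.assoc mult.left_commute)
qed

lemma perm_act_column_stabilizer:
  assumes "\<pi> \<in> column_stabilizer X \<mu> t"
  shows "perm_act \<pi> (e t) = cscale (of_int (sign \<pi>)) (e t)"
  using assms by (simp add: perm_act_polytabloid polytabloid_column_stabilizer column_stabilizer_permutes)

end

subsection \<open>Alternating vectors and the Schur lemma\<close>

text \<open>The second summand is there so that equality of the sums forces \<open>S = {1..card S}\<close>.\<close>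

lemma sum_positive_set:
  fixes S :: "nat set"
  assumes "finite S" and "0 \<notin> S"
  shows "\<Sum>{1..card S} + card (S - {1..card S}) \<le> \<Sum>S"
proof -
  define A where "A = {1..card S}"
  have [simp]: "finite A" "card A = card S" by (auto simp: A_def)
  \<comment> \<open>Equally many elements are missing from the initial segment and surplus to it. A
    missing one is at most \<open>card S\<close>, a surplus one is larger, so each exchange costs at
    least 1.\<close>
  have c: "card (A - S) = card (S - A)"
    using assms by (simp add: card_Diff_subset_Int Int_commute)
  have "\<Sum>(A - S) \<le> of_nat (card (A - S)) * card S"
    by (rule sum_bounded_above) (simp add: A_def)
  moreover have "of_nat (card (S - A)) * Suc (card S) \<le> \<Sum>(S - A)"
    by (rule sum_bounded_below) (use assms(2) in \<open>force simp: A_def Suc_le_eq not_le\<close>)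
  ultimately have "\<Sum>(A - S) + card (S - A) \<le> \<Sum>(S - A)"
    by (simp add: c)
  moreover have "\<Sum>S = \<Sum>(S \<inter> A) + \<Sum>(S - A)" "\<Sum>A = \<Sum>(S \<inter> A) + \<Sum>(A - S)"
    using sum.Int_Diff[of S "\<lambda>x. x" A] sum.Int_Diff[of A "\<lambda>x. x" S] assms(1)
    by (auto simp: Int_commute)
  ultimately show ?thesis by (simp add: A_def)
qed

lemma cscale_homI:
  assumes "\<And>u v. T (u + v) = T u + T v" and "\<And>c v. T (cscale c v) = cscale c (T v)"
  shows "module_hom cscale cscale T"
  using assms by (simp add: module_hom_iff cfun.module_axioms)

context specht_module
begin

text \<open>A tabloid seen as a map from entries to row numbers. The description is meaningful only
  for entries in \<open>X\<close> of members of \<open>tabloids\<close>, whose row sets are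
  disjoint.\<close>

definition row :: "(nat \<Rightarrow> nat set) \<Rightarrow> nat \<Rightarrow> nat" where
  "row x a = (THE i. a \<in> x i)"

lemma tabloid_memD: "a \<in> tabloid \<mu> t i \<Longrightarrow> \<exists>c\<in>D. fst c = i \<and> a = t c"
  by (auto simp: tabloid_def)

lemma filling_inj: "filling t \<Longrightarrow> c \<in> D \<Longrightarrow> c' \<in> D \<Longrightarrow> t c = t c' \<longleftrightarrow> c = c'"
  by (auto simp: filling_def bij_betw_def inj_on_def)

lemma filling_mem: "filling t \<Longrightarrow> c \<in> D \<Longrightarrow> t c \<in> X"
  by (auto simp: filling_def bij_betw_def)

lemma filling_surj: "filling t \<Longrightarrow> a \<in> X \<Longrightarrow> \<exists>c\<in>D. a = t c"
  by (auto simp: filling_def bij_betw_def)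

lemma tabloid_mem_iff: "filling t \<Longrightarrow> c \<in> D \<Longrightarrow> t c \<in> tabloid \<mu> t i \<longleftrightarrow> fst c = i"
  by (auto simp: tabloid_def filling_inj)

lemma row_tabloid: "filling t \<Longrightarrow> c \<in> D \<Longrightarrow> row (tabloid \<mu> t) (t c) = fst c"
  by (simp add: row_def tabloid_mem_iff)

lemma tabloid_in: "filling t \<Longrightarrow> tabloid \<mu> t \<in> tabloids"
  by (simp add: tabloids_def)

lemma tabloidsE:
  assumes "x \<in> tabloids"
  obtains t where "filling t" and "x = tabloid \<mu> t"
  using assms by (auto simp: tabloids_def)

lemma mem_iff_row:
  assumes "x \<in> tabloids"
  shows "a \<in> x i \<longleftrightarrow> a \<in> X \<and> row x a = i"
proof -
  obtain s where s: "filling s" "x = tabloid \<mu> s"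
    using assms by (rule tabloidsE)
  show ?thesis
  proof
    assume "a \<in> x i"
    then show "a \<in> X \<and> row x a = i"
      using tabloid_memD s filling_mem row_tabloid by blast
  next
    assume "a \<in> X \<and> row x a = i"
    then show "a \<in> x i"
      using filling_surj[OF s(1)] s tabloid_mem_iff row_tabloid by metis
  qed
qed

lemma tabloid_eqI:
  assumes "x \<in> tabloids" and "y \<in> tabloids" and "\<And>a. a \<in> X \<Longrightarrow> row x a = row y a"
  shows "x = y"
  by (rule ext, rule Set.set_eqI) (use assms in \<open>auto simp: mem_iff_row\<close>)

lemma perm_image_tabloids:
  assumes "x \<in> tabloids" and "\<sigma> permutes X"
  shows "perm_image \<sigma> x \<in> tabloids"
  using assms by (metis filling_perm perm_image_tabloid tabloidsE tabloid_in)

lemma row_perm_image: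
  assumes "x \<in> tabloids" and "\<sigma> permutes X" and "a \<in> X"
  shows "row (perm_image \<sigma> x) a = row x (Hilbert_Choice.inv \<sigma> a)"
proof -
  have "Hilbert_Choice.inv \<sigma> a \<in> x (row x (Hilbert_Choice.inv \<sigma> a))"
    using assms by (simp add: mem_iff_row permutes_in_image permutes_inv)
  then have "a \<in> perm_image \<sigma> x (row x (Hilbert_Choice.inv \<sigma> a))"
    unfolding perm_image_def using assms(2) by (metis image_eqI permutes_inverses(1))
  then show ?thesis
    using mem_iff_row[OF perm_image_tabloids[OF assms(1,2)]] by simp
qed

text \<open>All tabloids of one shape have equally many entries in each row, so the total of the row
  numbers is an invariant of the shape, in whatever order the entries are visited.\<close>

lemma sum_row:
  assumes "x \<in> tabloids" and "filling t"
  shows "(\<Sum>c\<in>D. row x (t c)) = (\<Sum>c\<in>D. fst c)"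
proof -
  obtain s where s: "filling s" "x = tabloid \<mu> s"
    using assms(1) by (rule tabloidsE)
  have "(\<Sum>c\<in>D. row x (t c)) = (\<Sum>a\<in>X. row x a)"
    using assms(2) unfolding filling_def by (rule sum.reindex_bij_betw)
  also have "\<dots> = (\<Sum>c\<in>D. row x (s c))"
    using s(1) unfolding filling_def by (rule sum.reindex_bij_betw[symmetric])
  also have "\<dots> = (\<Sum>c\<in>D. fst c)"
    using s by (simp add: row_tabloid)
  finally show ?thesis .
qed

lemma row_pos:
  assumes "x \<in> tabloids" and "a \<in> X"
  shows "row x a > 0"
proof -
  obtain s where "filling s" "x = tabloid \<mu> s"
    using assms(1) by (rule tabloidsE)
  then show ?thesis
    using filling_surj[OF _ assms(2)] row_tabloid by (fastforce simp: diagram_def)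
qed

text \<open>Row lengths weakly decrease, so a column is closed under going up. Its row sum is
  therefore the least possible for that many distinct positive rows.\<close>

lemma column_rows: "fst ` {c \<in> D. snd c = j} = {1..card {c \<in> D. snd c = j}}"
proof -
  define S where "S = fst ` {c \<in> D. snd c = j}"
  have fin: "finite S" unfolding S_def using finite_D by auto
  have "card S = card {c \<in> D. snd c = j}"
    unfolding S_def by (intro card_image) (auto simp: inj_on_def prod_eq_iff)
  moreover have "S = {1..card S}"
  proof (cases "S = {}")
    case False
    have down: "i' \<in> S" if "i \<in> S" "1 \<le> i'" "i' \<le> i" for i i'
    proof -
      have "(i, j) \<in> D" using that(1) by (auto simp: S_def)
      then have "(i', j) \<in> D"
        using partition_antimono[OF part that(2,3)] that(2) by (auto simp: diagram_def)
      then show ?thesis by (force simp: S_def)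
    qed
    define m where "m = Max S"
    have "S = {1..m}"
      unfolding m_def
    proof (intro equalityI subsetI)
      fix i assume "i \<in> S"
      then show "i \<in> {1..Max S}" using fin by (auto simp: S_def diagram_def)
    next
      fix i assume "i \<in> {1..Max S}"
      then show "i \<in> S" using down[OF Max_in[OF fin False]] by auto
    qed
    then show ?thesis by simp
  qed simp
  ultimately show ?thesis by (simp add: S_def)
qed

text \<open>The rows in \<open>x\<close> of the entries of a column of \<open>t\<close> are distinct, so their sum is at least that
  of the rows in \<open>t\<close>. The totals over all columns agree, hence so do the sets of rows in each column.\<close>

lemma column_stabilizer_reaches:
  assumes t: "filling t" and x: "x \<in> tabloids"
    and inj: "\<And>c c'. c \<in> D \<Longrightarrow> c' \<in> D \<Longrightarrow> snd c = snd c' \<Longrightarrow> row x (t c) = row x (t c') \<Longrightarrow> c = c'"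
  obtains \<pi> where "\<pi> \<in> column_stabilizer X \<mu> t" and "x = tabloid \<mu> (\<pi> \<circ> t)"
proof -
  define C where "C j = {c \<in> D. snd c = j}" for j
  define R where "R j = (\<lambda>c. row x (t c)) ` C j" for j
  have C: "finite (C j)" for j using finite_D by (simp add: C_def)
  have injC: "inj_on (\<lambda>c. row x (t c)) (C j)" for j
    using inj by (auto simp: inj_on_def C_def)
  have fstC: "fst ` C j = {1..card (C j)}" for j
    using column_rows by (simp add: C_def)
  have R: "finite (R j)" "0 \<notin> R j" "card (R j) = card (C j)" for j
  proof -
    show "finite (R j)" using C by (simp add: R_def)
    show "0 \<notin> R j"
    proof
      assume "0 \<in> R j"
      then obtain c where "c \<in> D" "row x (t c) = 0" by (auto simp: R_def C_def)
      then show False using row_pos[OF x filling_mem[OF t]] by (metis less_irrefl)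
    qed
    show "card (R j) = card (C j)" unfolding R_def using injC by (rule card_image)
  qed
  have split: "(\<Sum>c\<in>D. f c) = (\<Sum>j\<in>snd ` D. \<Sum>c\<in>C j. f c)" for f :: "nat \<times> nat \<Rightarrow> nat"
    unfolding C_def by (rule sum.image_gen[OF finite_D])
  have rowsum: "(\<Sum>c\<in>C j. row x (t c)) = \<Sum>(R j)" for j
    unfolding R_def using injC by (simp add: sum.reindex)
  have fstsum: "(\<Sum>c\<in>C j. fst c) = \<Sum>{1..card (R j)}" for j
  proof -
    have "inj_on fst (C j)" by (auto simp: C_def inj_on_def prod_eq_iff)
    then have "(\<Sum>c\<in>C j. fst c) = \<Sum>(fst ` C j)" by (simp add: sum.reindex)
    then show ?thesis by (simp add: R fstC)
  qed
  have "(\<Sum>j\<in>snd ` D. \<Sum>{1..card (R j)}) = (\<Sum>j\<in>snd ` D. \<Sum>(R j))"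
    using sum_row[OF x t] unfolding split rowsum fstsum by simp
  \<comment> \<open>In each column the left side is a lower bound; since the totals agree, no column
    can be strict.\<close>
  then have eq: "\<Sum>{1..card (R j)} = \<Sum>(R j)" if "j \<in> snd ` D" for j
    using that finite_D sum_positive_set[OF R(1,2)]
    by (intro sum_mono_inv[of "\<lambda>j. \<Sum>{1..card (R j)}" "snd ` D" "\<lambda>j. \<Sum>(R j)"])
      (auto intro: add_leD1)
  have sub: "R j \<subseteq> fst ` C j" if "j \<in> snd ` D" for j
  proof -
    have "card (R j - {1..card (R j)}) = 0"
      using sum_positive_set[OF R(1,2), of j] eq[OF that] by linarith
    then show ?thesis using R by (simp add: fstC)
  qed
  \<comment> \<open>\<open>p\<close> moves a cell, within its column, to the row where
    \<open>x\<close> has its entry; it is injective by \<open>inj\<close>. The filling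
    \<open>s\<close> below then has the column sets of \<open>t\<close> and the rows of
    \<open>x\<close>.\<close>
  define p where "p c = (row x (t c), snd c)" for c
  have p_mem: "p c \<in> D" if "c \<in> D" for c
  proof -
    have "row x (t c) \<in> R (snd c)" using that by (auto simp: R_def C_def)
    then show ?thesis using sub[of "snd c"] that by (force simp: p_def C_def)
  qed
  have "inj_on p D" using inj by (auto simp: inj_on_def p_def)
  then have p: "bij_betw p D D"
    using p_mem finite_D by (simp add: bij_betw_def endo_inj_surj image_subset_iff)
  define s where "s = t \<circ> inv_into D p"
  have s_p: "s (p c) = t c" if "c \<in> D" for c
    using that p by (simp add: s_def bij_betw_def)
  have s: "filling s"
    unfolding filling_def s_def
    using bij_betw_trans[OF bij_betw_inv_into[OF p]] t by (auto simp: filling_def)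
  have D_p: "\<exists>c'\<in>D. c = p c'" if "c \<in> D" for c
    using that p by (auto simp: bij_betw_def)
  have "row (tabloid \<mu> s) a = row x a" if a: "a \<in> X" for a
  proof -
    obtain c where c: "c \<in> D" "a = t c" using filling_surj[OF t a] by auto
    have "row (tabloid \<mu> s) (s (p c)) = fst (p c)"
      using s p_mem[OF c(1)] by (rule row_tabloid)
    then show ?thesis unfolding s_p[OF c(1)] using c(2) by (simp add: p_def)
  qed
  then have xs: "x = tabloid \<mu> s"
    using tabloid_eqI[OF x tabloid_in[OF s]] by simp
  obtain \<pi> where \<pi>: "\<pi> permutes X" "\<And>c. c \<in> D \<Longrightarrow> s c = \<pi> (t c)"
    using filling_rel[OF s t] by blast
  have "\<pi> ` column t j = column t j" for j
  proof -
    have "\<pi> ` column t j = s ` C j"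
      using \<pi>(2) by (force simp: column_def C_def image_image)
    also have "C j = p ` C j"
    proof (intro equalityI subsetI)
      fix c assume "c \<in> C j"
      then show "c \<in> p ` C j" using D_p[of c] by (auto simp: C_def p_def)
    qed (use p_mem in \<open>auto simp: C_def p_def\<close>)
    also have "s ` p ` C j = column t j"
      using s_p by (force simp: column_def C_def image_image)
    finally show ?thesis .
  qed
  then have "\<pi> \<in> column_stabilizer X \<mu> t"
    using \<pi>(1) by (simp add: column_stabilizer_iff)
  moreover have "x = tabloid \<mu> (\<pi> \<circ> t)"
    unfolding xs by (rule tabloid_cong) (simp add: \<pi>(2))
  ultimately show ?thesis by (rule that)
qed

lemma transpose_column_stabilizer:
  assumes t: "filling t" and c: "c \<in> D" "c' \<in> D" "snd c = snd c'"
  shows "transpose (t c) (t c') \<in> column_stabilizer X \<mu> t"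
proof -
  have *: "t c \<in> column t j \<longleftrightarrow> t c' \<in> column t j" for j
  proof -
    have "t b \<in> column t j \<longleftrightarrow> snd b = j" if "b \<in> D" for b
      using that by (auto simp: column_def filling_inj[OF t])
    then show ?thesis using c by simp
  qed
  have "transpose (t c) (t c') ` column t j = column t j" for j
    using * by (simp add: transpose_image_eq)
  then show ?thesis
    using filling_mem[OF t] c by (simp add: column_stabilizer_iff permutes_swap_id)
qed

text \<open>The transposition of two entries in one column of \<open>t\<close> that share a row of
  \<open>x\<close> fixes \<open>x\<close> but negates the value there.\<close>

lemma alternating_collision:
  assumes t: "filling t" and x: "x \<in> tabloids"
    and anti: "\<And>\<pi>. \<pi> \<in> column_stabilizer X \<mu> t \<Longrightarrow> perm_act \<pi> u = cscale (of_int (sign \<pi>)) u"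
    and c: "c \<in> D" "c' \<in> D" "snd c = snd c'" "c \<noteq> c'" "row x (t c) = row x (t c')"
  shows "u x = 0"
proof -
  define \<tau> where "\<tau> = transpose (t c) (t c')"
  have cs: "\<tau> \<in> column_stabilizer X \<mu> t"
    unfolding \<tau>_def using t c(1-3) by (rule transpose_column_stabilizer)
  have ne: "t c \<noteq> t c'" using filling_inj[OF t] c by auto
  have "perm_image (Hilbert_Choice.inv \<tau>) x = x"
    using filling_mem[OF t] c by (auto simp: perm_image_def \<tau>_def mem_iff_row[OF x])
  then have "perm_act \<tau> u x = u x" by (simp add: perm_act_apply)
  moreover have "perm_act \<tau> u x = - u x"
    using anti[OF cs] ne by (simp add: \<tau>_def sign_swap_id)
  ultimately show ?thesis by simp
qed

text \<open>Each tabloid either has a collision in some column of \<open>t\<close>, or is a column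
  permutation away from the tabloid of \<open>t\<close>, where the value is known up to
  sign.\<close>

lemma alternating_zero:
  assumes t: "filling t" and supp: "\<And>x. x \<notin> tabloids \<Longrightarrow> u x = 0"
    and anti: "\<And>\<pi>. \<pi> \<in> column_stabilizer X \<mu> t \<Longrightarrow> perm_act \<pi> u = cscale (of_int (sign \<pi>)) u"
    and zero: "u (tabloid \<mu> t) = 0"
  shows "u = 0"
proof
  fix x
  show "u x = 0 x"
  proof (cases "x \<in> tabloids \<and> (\<forall>c\<in>D. \<forall>c'\<in>D. snd c = snd c' \<and> row x (t c) = row x (t c') \<longrightarrow> c = c')")
    case True
    then obtain \<pi> where \<pi>: "\<pi> \<in> column_stabilizer X \<mu> t" "x = tabloid \<mu> (\<pi> \<circ> t)"
      using column_stabilizer_reaches[OF t] by metis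
    have p: "\<pi> permutes X" using \<pi>(1) by (rule column_stabilizer_permutes)
    have "perm_image (Hilbert_Choice.inv \<pi>) x = tabloid \<mu> t"
      using p by (simp add: \<pi>(2) perm_image_tabloid o_assoc permutes_inv_o)
    then have "of_int (sign \<pi>) * u x = 0"
      using anti[OF \<pi>(1)] zero by (metis cscale_apply perm_act_apply)
    then show ?thesis by simp
  next
    case False
    then show ?thesis using supp alternating_collision[OF t _ anti] by fastforce
  qed
qed

lemma polytabloid_supp:
  assumes "filling t" and "x \<notin> tabloids"
  shows "e t x = 0"
  unfolding polytabloid_def
  using assms filling_perm[OF assms(1) column_stabilizer_permutes] tabloid_in
  by (intro sum.neutral) auto

text \<open>Column and row determine a cell, so a column permutation that also preserves the rows of
  \<open>t\<close> is the identity: exactly one summand survives.\<close>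

lemma polytabloid_self:
  assumes t: "filling t"
  shows "e t (tabloid \<mu> t) = 1"
proof -
  have eq: "tabloid \<mu> (\<pi> \<circ> t) = tabloid \<mu> t \<longleftrightarrow> \<pi> = id" if \<pi>: "\<pi> \<in> column_stabilizer X \<mu> t" for \<pi>
  proof
    assume tab: "tabloid \<mu> (\<pi> \<circ> t) = tabloid \<mu> t"
    have p: "\<pi> permutes X" using \<pi> by (rule column_stabilizer_permutes)
    show "\<pi> = id"
    proof
      fix a
      show "\<pi> a = id a"
      proof (cases "a \<in> X")
        case True
        then obtain c where c: "c \<in> D" "a = t c" using filling_surj[OF t] by blast
        have "\<pi> a \<in> \<pi> ` column t (snd c)" using c by (auto simp: column_def)
        then have "\<pi> a \<in> column t (snd c)" using \<pi> by (simp add: column_stabilizer_iff)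
        then obtain c' where c': "c' \<in> D" "snd c' = snd c" "\<pi> a = t c'" by (auto simp: column_def)
        have "fst c = fst c'"
          using row_tabloid[OF filling_perm[OF t p] c(1)] row_tabloid[OF t c'(1)] c c' tab by simp
        then have "c = c'" using c'(2) by (simp add: prod_eq_iff)
        then show ?thesis using c c' by simp
      qed (use p in \<open>simp add: permutes_not_in\<close>)
    qed
  qed simp
  have id: "id \<in> column_stabilizer X \<mu> t" by (simp add: column_stabilizer_iff permutes_id)
  have "e t (tabloid \<mu> t) = (\<Sum>\<pi>\<in>column_stabilizer X \<mu> t. if \<pi> = id then 1 else 0)"
    unfolding polytabloid_def by (rule sum.cong) (auto simp: eq sign_id)
  then show ?thesis using id finite_column_stabilizer by simp
qed

lemma specht_induct [consumes 1, case_names subspace polytabloid]: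
  assumes "v \<in> M" and "cfun.subspace {v. P v}" and "\<And>t. filling t \<Longrightarrow> P (e t)"
  shows "P v"
  using assms(1) unfolding specht_eq_span
  by (rule cfun.span_induct) (use assms(2,3) in auto)

lemma specht_supp:
  assumes "v \<in> M" and "x \<notin> tabloids"
  shows "v x = 0"
  using assms(1)
  by (induction rule: specht_induct) (use assms(2) polytabloid_supp in \<open>auto simp: cfun.subspace_def\<close>)

lemma perm_act_specht:
  assumes "v \<in> M" and \<sigma>: "\<sigma> permutes X"
  shows "perm_act \<sigma> v \<in> M"
  using assms(1)
proof (induction rule: specht_induct)
  case subspace
  have "cfun.subspace M" by (simp add: specht_def)
  then show ?case
    by (auto simp: cfun.subspace_def perm_act_add perm_act_cscale)
      (simp add: perm_act_def zero_fun_def)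
next
  case (polytabloid t)
  then show ?case
    by (simp add: perm_act_polytabloid \<sigma> filling_perm polytabloid_in_specht)
qed

text \<open>Schur's lemma: the vectors that alternate under the column stabilizer of \<open>t\<close> form the line
  spanned by \<open>e t\<close>, and an equivariant map preserves this line, while \<open>e t\<close> generates the module.\<close>

lemma equivariant_scalar:
  assumes hom: "module_hom cscale cscale T"
    and comm: "\<And>\<sigma> v. \<sigma> permutes X \<Longrightarrow> T (perm_act \<sigma> v) = perm_act \<sigma> (T v)"
    and t: "filling t" and supp: "\<And>x. x \<notin> tabloids \<Longrightarrow> T (e t) x = 0"
  obtains k where "\<And>v. v \<in> M \<Longrightarrow> T v = cscale k v"
proof -
  \<comment> \<open>\<open>e t\<close> has value 1 at its own tabloid, so this is the only candidate
    for the scalar.\<close>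
  define k where "k = T (e t) (tabloid \<mu> t)"
  have "T (e t) - cscale k (e t) = 0"
  proof (rule alternating_zero[OF t])
    fix \<pi> assume \<pi>: "\<pi> \<in> column_stabilizer X \<mu> t"
    have "perm_act \<pi> (T (e t)) = T (perm_act \<pi> (e t))"
      using comm column_stabilizer_permutes[OF \<pi>] by simp
    also have "\<dots> = cscale (of_int (sign \<pi>)) (T (e t))"
      by (simp add: perm_act_column_stabilizer[OF \<pi>] module_hom.scale[OF hom])
    finally show "perm_act \<pi> (T (e t) - cscale k (e t)) = cscale (of_int (sign \<pi>)) (T (e t) - cscale k (e t))"
      by (simp add: perm_act_diff perm_act_cscale perm_act_column_stabilizer[OF \<pi>]
          cfun.scale_right_diff_distrib cfun.scale_left_commute)
  qed (use supp polytabloid_supp[OF t] polytabloid_self[OF t] in \<open>auto simp: k_def\<close>)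
  then have Tet: "T (e t) = cscale k (e t)" by simp
  have "T v = cscale k v" if "v \<in> M" for v
    using that
  proof (induction rule: specht_induct)
    case subspace
    show ?case
      by (auto simp: cfun.subspace_def module_hom.add[OF hom] module_hom.scale[OF hom]
          module_hom.zero[OF hom] fun_eq_iff algebra_simps)
  next
    case (polytabloid s)
    obtain \<sigma> where \<sigma>: "\<sigma> permutes X" "\<And>c. c \<in> D \<Longrightarrow> s c = \<sigma> (t c)"
      using filling_rel[OF polytabloid t] by blast
    have "e s = e (\<sigma> \<circ> t)"
      by (rule polytabloid_cong) (simp add: \<sigma>)
    then have "e s = perm_act \<sigma> (e t)"
      by (simp add: perm_act_polytabloid \<sigma>(1))
    then show ?case by (simp add: comm \<sigma>(1) Tet perm_act_cscale)
  qed
  then show ?thesis by (rule that)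
qed

end

subsection \<open>Schur orthogonality for Specht modules\<close>

context specht_module
begin

text \<open>No conjugate in either argument: linearity in both is what lets the operators built from
  it be complex linear, and the form stays symmetric.\<close>

definition bform :: "((nat \<Rightarrow> nat set) \<Rightarrow> complex) \<Rightarrow> ((nat \<Rightarrow> nat set) \<Rightarrow> complex) \<Rightarrow> complex" where
  "bform u v = (\<Sum>x\<in>tabloids. u x * v x)"

lemma bform_commute: "bform u v = bform v u"
  by (simp add: bform_def mult.commute)

lemma bform_add: "bform u (v + w) = bform u v + bform u w"
  by (simp add: bform_def distrib_left sum.distrib)

lemma bform_cscale: "bform u (cscale c v) = c * bform u v"
  by (simp add: bform_def sum_distrib_left mult.left_commute)

lemma bform_sum: "bform u (\<Sum>i\<in>A. f i) = (\<Sum>i\<in>A. bform u (f i))"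
  by (simp add: bform_def sum_fun_apply sum_distrib_left) (rule sum.swap)

lemma bform_perm:
  assumes \<sigma>: "\<sigma> permutes X"
  shows "bform (perm_act \<sigma> u) v = bform u (perm_act (Hilbert_Choice.inv \<sigma>) v)"
  unfolding bform_def perm_act_apply
  by (rule sum.reindex_bij_witness[where i = "perm_image \<sigma>" and j = "perm_image (Hilbert_Choice.inv \<sigma>)"])
    (use \<sigma> in \<open>auto simp: perm_image_tabloids permutes_inv permutes_inv_inv permutes_inv_o
        simp flip: perm_image_comp\<close>)

lemma perm_act_perm_act:
  "\<sigma> permutes X \<Longrightarrow> \<tau> permutes X \<Longrightarrow> perm_act \<sigma> (perm_act \<tau> v) = perm_act (\<sigma> \<circ> \<tau>) v"
  by (simp add: perm_act_comp permutes_bij)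

lemma polytabloid_Ints: "e t x \<in> \<int>"
  unfolding polytabloid_def by (intro Ints_sum Ints_mult) auto

text \<open>The orbit of a polytabloid is a tight frame of the module: averaging the rank-one operator
  \<open>bform (e t) \<cdot> e t\<close> over the group gives an equivariant operator.\<close>

lemma tight_frame:
  assumes t: "filling t"
  obtains c where "c \<noteq> 0"
    and "\<And>v. v \<in> M \<Longrightarrow>
      (\<Sum>\<tau> | \<tau> permutes X. cscale (bform (perm_act \<tau> (e t)) v) (perm_act \<tau> (e t))) = cscale c v"
proof -
  define T where
    "T v = (\<Sum>\<tau> | \<tau> permutes X. cscale (bform (perm_act \<tau> (e t)) v) (perm_act \<tau> (e t)))" for v
  have hom: "module_hom cscale cscale T"
    by (rule cscale_homI)
      (auto simp: T_def fun_eq_iff sum_fun_apply bform_add bform_cscale distrib_right sum.distrib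
        sum_distrib_left mult.assoc)
  have comm: "T (perm_act \<sigma> v) = perm_act \<sigma> (T v)" if \<sigma>: "\<sigma> permutes X" for \<sigma> v
  proof -
    have "T (perm_act \<sigma> v) =
        (\<Sum>\<tau> | \<tau> permutes X. cscale (bform (perm_act (\<sigma> \<circ> \<tau>) (e t)) (perm_act \<sigma> v)) (perm_act (\<sigma> \<circ> \<tau>) (e t)))"
      unfolding T_def by (rule permutes_sum_left[OF \<sigma>, symmetric])
    also have "\<dots> = (\<Sum>\<tau> | \<tau> permutes X. cscale (bform (perm_act \<tau> (e t)) v) (perm_act \<sigma> (perm_act \<tau> (e t))))"
    proof (rule sum.cong)
      fix \<tau> assume "\<tau> \<in> {\<tau>. \<tau> permutes X}"
      then have "perm_act (\<sigma> \<circ> \<tau>) (e t) = perm_act \<sigma> (perm_act \<tau> (e t))"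
        using \<sigma> by (simp add: perm_act_perm_act)
      then show "cscale (bform (perm_act (\<sigma> \<circ> \<tau>) (e t)) (perm_act \<sigma> v)) (perm_act (\<sigma> \<circ> \<tau>) (e t)) =
          cscale (bform (perm_act \<tau> (e t)) v) (perm_act \<sigma> (perm_act \<tau> (e t)))"
        using \<sigma> by (simp add: bform_perm perm_act_perm_act permutes_inv permutes_inv_o)
    qed simp
    finally show ?thesis
      by (simp add: T_def perm_act_sum perm_act_cscale)
  qed
  have supp: "T (e t) x = 0" if "x \<notin> tabloids" for x
    using that t by (auto simp: T_def sum_fun_apply perm_act_polytabloid polytabloid_supp filling_perm)
  obtain c where c: "\<And>v. v \<in> M \<Longrightarrow> T v = cscale c v"
    using equivariant_scalar[OF hom comm t supp] by blast
  \<comment> \<open>To exclude c = 0, pair the image of \<open>e t\<close> with \<open>e t\<close>: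
    the result is the sum of the squares of the integers \<open>k \<tau>\<close>, and
    \<open>k id\<close> is positive since \<open>e t\<close> has value 1 at its own tabloid.\<close>
  have "bform (perm_act \<tau> (e t)) (e t) \<in> \<int>" for \<tau>
    unfolding bform_def perm_act_apply by (intro Ints_sum Ints_mult polytabloid_Ints)
  then have "\<forall>\<tau>. \<exists>k. bform (perm_act \<tau> (e t)) (e t) = of_int k"
    by (meson Ints_cases)
  then obtain k where k: "\<And>\<tau>. bform (perm_act \<tau> (e t)) (e t) = of_int (k \<tau>)"
    by metis
  have "\<forall>x. \<exists>j. e t x = of_int j"
    by (metis Ints_cases polytabloid_Ints)
  then obtain j where j: "\<And>x. e t x = of_int (j x)"
    by metis
  have "of_int (k id) = (of_int (\<Sum>x\<in>tabloids. j x * j x) :: complex)"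
    using k[of id] by (simp add: bform_def j)
  then have "k id = (\<Sum>x\<in>tabloids. j x * j x)"
    by (simp only: of_int_eq_iff)
  moreover have "j (tabloid \<mu> t) = 1"
    using polytabloid_self[OF t] by (simp add: j)
  ultimately have "k id > 0"
    by (simp only:) (rule sum_pos2[OF finite_tabloids tabloid_in[OF t]], simp_all)
  then have "0 < (\<Sum>\<tau> | \<tau> permutes X. k \<tau> * k \<tau>)"
    using finite_perms permutes_id by (intro sum_pos2[where i = id]) auto
  moreover have "bform (e t) (T (e t)) = of_int (\<Sum>\<tau> | \<tau> permutes X. k \<tau> * k \<tau>)"
    by (simp add: T_def bform_sum bform_cscale bform_commute[of "e t"] k)
  moreover have "bform (e t) (T (e t)) = c * bform (e t) (e t)"
    by (simp add: c[OF polytabloid_in_specht[OF t]] bform_cscale)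
  ultimately have "c \<noteq> 0"
    by (metis less_irrefl mult_zero_left of_int_eq_0_iff)
  then show ?thesis
    using c that unfolding T_def by blast
qed

section \<open>Bases, dimension and traces of the Specht module\<close>

lemma finite_independent:
  assumes "cfun.independent B" and "B \<subseteq> M"
  shows "finite B"
  using cfun.independent_span_bound[OF finite_spanning] assms by (simp add: specht_eq_span)

text \<open>Shows that the choice inside \<open>trace_on\<close> is of an existing basis, finite and
  the same for all operators, so that traces can be compared.\<close>

lemma trace_on_basis:
  obtains B where "cfun.independent B" "cfun.span B = M" "finite B"
    and "\<And>T. trace_on M T = (\<Sum>b\<in>B. cfun.representation B (T b) b)"
proof -
  define B where "B = (SOME B. cfun.independent B \<and> cfun.span B = M)"
  have "\<exists>B. cfun.independent B \<and> cfun.span B = M"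
    using cfun.basis_exists[of M] cfun.span_mono[of _ M]
    by (metis cfun.span_eq_iff cfun.subspace_span order_antisym specht_def)
  then have B: "cfun.independent B \<and> cfun.span B = M"
    unfolding B_def by (rule someI_ex)
  then have "finite B"
    using finite_independent cfun.span_superset by blast
  with B show ?thesis
    by (intro that) (auto simp: trace_on_def B_def[symmetric])
qed

lemma dim_specht:
  assumes "cfun.span B = M" and "cfun.independent B"
  shows "cfun.dim M = card B"
  using cfun.dim_eq_card[of B M] assms by (metis cfun.span_span)

lemma dim_eq_trace: "of_nat (cfun.dim M) = trace_on M (\<lambda>v. v)"
proof -
  obtain B where B: "cfun.independent B" "cfun.span B = M" "finite B"
    and tr: "\<And>T. trace_on M T = (\<Sum>b\<in>B. cfun.representation B (T b) b)"
    using trace_on_basis by blast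
  have "cfun.dim M = card B"
    using B(2,1) by (rule dim_specht)
  then show ?thesis
    by (simp add: tr cfun.representation_basis[OF B(1)])
qed

text \<open>Apply \<open>T\<close> to the frame expansion of a basis vector b and take the b-th
  coordinate. Summing over b and exchanging the sums reassembles each \<open>T (?e \<tau>)\<close>
  from its coordinates.\<close>

lemma trace_on_frame:
  assumes t: "filling t" and c: "c \<noteq> 0"
    and frame: "\<And>v. v \<in> M \<Longrightarrow>
      (\<Sum>\<tau> | \<tau> permutes X. cscale (bform (perm_act \<tau> (e t)) v) (perm_act \<tau> (e t))) = cscale c v"
    and hom: "module_hom cscale cscale T" and T: "\<And>v. v \<in> M \<Longrightarrow> T v \<in> M"
  shows "c * trace_on M T = (\<Sum>\<tau> | \<tau> permutes X. bform (perm_act \<tau> (e t)) (T (perm_act \<tau> (e t))))"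
proof -
  obtain B where B: "cfun.independent B" "cfun.span B = M" "finite B"
    and tr: "\<And>T. trace_on M T = (\<Sum>b\<in>B. cfun.representation B (T b) b)"
    using trace_on_basis by blast
  let ?r = "cfun.representation B"
  let ?e = "\<lambda>\<tau>. perm_act \<tau> (e t)"
  have Te: "T (?e \<tau>) \<in> cfun.span B" if "\<tau> permutes X" for \<tau>
    using that t B(2) by (simp add: T perm_act_specht polytabloid_in_specht)
  have "c * ?r (T b) b = (\<Sum>\<tau> | \<tau> permutes X. bform (?e \<tau>) b * ?r (T (?e \<tau>)) b)" if "b \<in> B" for b
  proof -
    have bM: "b \<in> M" using that B(2) cfun.span_base by blast
    have "cscale c (T b) = T (cscale c b)"
      by (simp add: module_hom.scale[OF hom])
    also have "\<dots> = (\<Sum>\<tau> | \<tau> permutes X. cscale (bform (?e \<tau>) b) (T (?e \<tau>)))"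
      by (simp add: frame[OF bM, symmetric] module_hom.sum[OF hom] module_hom.scale[OF hom])
    finally have "?r (cscale c (T b)) b = ?r (\<Sum>\<tau> | \<tau> permutes X. cscale (bform (?e \<tau>) b) (T (?e \<tau>))) b"
      by simp
    moreover have "?r (\<Sum>\<tau> | \<tau> permutes X. cscale (bform (?e \<tau>) b) (T (?e \<tau>))) =
        (\<lambda>b'. \<Sum>\<tau> | \<tau> permutes X. ?r (cscale (bform (?e \<tau>) b) (T (?e \<tau>))) b')"
      using Te by (intro cfun.representation_sum[OF B(1)] cfun.span_scale) auto
    ultimately show ?thesis
      using Te T[OF bM] B(2) by (simp add: cfun.representation_scale[OF B(1)])
  qed
  then have "c * trace_on M T = (\<Sum>b\<in>B. \<Sum>\<tau> | \<tau> permutes X. bform (?e \<tau>) b * ?r (T (?e \<tau>)) b)"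
    by (simp add: tr[of T] sum_distrib_left)
  also have "\<dots> = (\<Sum>\<tau> | \<tau> permutes X. bform (?e \<tau>) (\<Sum>b\<in>B. cscale (?r (T (?e \<tau>)) b) b))"
    by (subst sum.swap) (simp add: bform_sum bform_cscale mult.commute)
  also have "\<dots> = (\<Sum>\<tau> | \<tau> permutes X. bform (?e \<tau>) (T (?e \<tau>)))"
    using Te by (simp add: cfun.sum_representation_eq[OF B(1) _ B(3)])
  finally show ?thesis .
qed

lemma perm_act_hom: "module_hom cscale cscale (perm_act \<sigma>)"
  by (rule cscale_homI) (simp_all add: perm_act_add perm_act_cscale)

lemma dim_specht_pos: "cfun.dim M > 0"
proof -
  obtain t where t: "filling t" using ex_filling by auto
  have "e t \<noteq> 0" using polytabloid_self[OF t] by (metis zero_fun_apply zero_neq_one)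
  obtain B where B: "cfun.independent B" "cfun.span B = M" "finite B"
    by (metis trace_on_basis)
  have "cfun.dim M = card B"
    using B(2,1) by (rule dim_specht)
  moreover have "B \<noteq> {}"
    using B(2) \<open>e t \<noteq> 0\<close> polytabloid_in_specht[OF t] by auto
  ultimately show ?thesis using B(3) by (simp add: card_gt_0_iff)
qed

text \<open>Averaging the rank-one operator that sends w to \<open>bform u w\<close> times
  \<open>v\<close> over all conjugations by the group gives an equivariant operator, hence a scalar
  k. Comparing traces gives k times the dimension as
  \<open>fact (card X) * bform u v\<close>.\<close>

lemma schur_orthogonality:
  assumes v: "v \<in> M" and w: "w \<in> M"
  shows "of_nat (cfun.dim M) *
      (\<Sum>\<sigma> | \<sigma> permutes X. bform u (perm_act (Hilbert_Choice.inv \<sigma>) w) * perm_act \<sigma> v x) =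
    fact (card X) * bform u v * w x"
proof -
  obtain t where t: "filling t" using ex_filling by auto
  obtain c where c: "c \<noteq> 0" and frame: "\<And>v. v \<in> M \<Longrightarrow>
      (\<Sum>\<tau> | \<tau> permutes X. cscale (bform (perm_act \<tau> (e t)) v) (perm_act \<tau> (e t))) = cscale c v"
    using tight_frame[OF t] by blast
  let ?e = "\<lambda>\<tau>. perm_act \<tau> (e t)"
  define T where
    "T w = (\<Sum>\<sigma> | \<sigma> permutes X. cscale (bform u (perm_act (Hilbert_Choice.inv \<sigma>) w)) (perm_act \<sigma> v))" for w
  have hom: "module_hom cscale cscale T"
    by (rule cscale_homI)
      (auto simp: T_def fun_eq_iff sum_fun_apply bform_add bform_cscale distrib_right sum.distrib
        sum_distrib_left mult.assoc perm_act_add perm_act_cscale)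
  have comm: "T (perm_act \<rho> w) = perm_act \<rho> (T w)" if \<rho>: "\<rho> permutes X" for \<rho> w
  proof -
    have "T (perm_act \<rho> w) = (\<Sum>\<sigma> | \<sigma> permutes X.
        cscale (bform u (perm_act (Hilbert_Choice.inv (\<rho> \<circ> \<sigma>)) (perm_act \<rho> w))) (perm_act (\<rho> \<circ> \<sigma>) v))"
      unfolding T_def by (rule permutes_sum_left[OF \<rho>, symmetric])
    also have "\<dots> = (\<Sum>\<sigma> | \<sigma> permutes X.
        cscale (bform u (perm_act (Hilbert_Choice.inv \<sigma>) w)) (perm_act \<rho> (perm_act \<sigma> v)))"
    proof (rule sum.cong)
      fix \<sigma> assume "\<sigma> \<in> {\<sigma>. \<sigma> permutes X}"
      then have \<sigma>: "\<sigma> permutes X" by simp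
      have "Hilbert_Choice.inv (\<rho> \<circ> \<sigma>) \<circ> \<rho> = Hilbert_Choice.inv \<sigma>"
        using \<rho> \<sigma> by (simp add: o_inv_distrib permutes_bij o_assoc[symmetric] permutes_inv_o)
      then show "cscale (bform u (perm_act (Hilbert_Choice.inv (\<rho> \<circ> \<sigma>)) (perm_act \<rho> w))) (perm_act (\<rho> \<circ> \<sigma>) v) =
          cscale (bform u (perm_act (Hilbert_Choice.inv \<sigma>) w)) (perm_act \<rho> (perm_act \<sigma> v))"
        using \<rho> \<sigma> by (simp add: perm_act_perm_act permutes_inv permutes_compose)
    qed simp
    finally show ?thesis
      by (simp add: T_def perm_act_sum perm_act_cscale)
  qed
  have TM: "T w \<in> M" for w
    unfolding T_def specht_def
    using perm_act_specht[OF v] by (intro cfun.span_sum cfun.span_scale) (auto simp: specht_def)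
  have supp: "T (e t) x = 0" if "x \<notin> tabloids" for x
    using that TM specht_supp by blast
  obtain k where k: "\<And>v. v \<in> M \<Longrightarrow> T v = cscale k v"
    using equivariant_scalar[OF hom comm t supp] by blast
  have eM: "?e \<tau> \<in> M" if "\<tau> permutes X" for \<tau>
    using that t by (simp add: perm_act_specht polytabloid_in_specht)
  have "c * of_nat (cfun.dim M) = (\<Sum>\<tau> | \<tau> permutes X. bform (?e \<tau>) (?e \<tau>))"
    unfolding dim_eq_trace by (rule trace_on_frame[OF t c frame]) (auto intro: cscale_homI)
  then have "c * (k * of_nat (cfun.dim M)) = (\<Sum>\<tau> | \<tau> permutes X. bform (?e \<tau>) (T (?e \<tau>)))"
    by (simp add: k eM bform_cscale sum_distrib_left mult.left_commute[of c])
  also have "\<dots> = (\<Sum>\<tau> | \<tau> permutes X. \<Sum>\<sigma> | \<sigma> permutes X.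
      bform u (perm_act (Hilbert_Choice.inv \<sigma> \<circ> \<tau>) (e t)) * bform (perm_act (Hilbert_Choice.inv \<sigma> \<circ> \<tau>) (e t)) v)"
  proof (rule sum.cong)
    fix \<tau> assume "\<tau> \<in> {\<tau>. \<tau> permutes X}"
    then have \<tau>: "\<tau> permutes X" by simp
    show "bform (?e \<tau>) (T (?e \<tau>)) = (\<Sum>\<sigma> | \<sigma> permutes X.
      bform u (perm_act (Hilbert_Choice.inv \<sigma> \<circ> \<tau>) (e t)) * bform (perm_act (Hilbert_Choice.inv \<sigma> \<circ> \<tau>) (e t)) v)"
      unfolding T_def bform_sum bform_cscale
    proof (rule sum.cong)
      fix \<sigma> assume "\<sigma> \<in> {\<sigma>. \<sigma> permutes X}"
      then have \<sigma>: "\<sigma> permutes X" by simp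
      show "bform u (perm_act (Hilbert_Choice.inv \<sigma>) (?e \<tau>)) * bform (?e \<tau>) (perm_act \<sigma> v) =
        bform u (perm_act (Hilbert_Choice.inv \<sigma> \<circ> \<tau>) (e t)) * bform (perm_act (Hilbert_Choice.inv \<sigma> \<circ> \<tau>) (e t)) v"
        using bform_perm[OF permutes_inv[OF \<sigma>], of "?e \<tau>" v] \<sigma> \<tau>
        by (simp add: perm_act_perm_act permutes_inv permutes_inv_inv)
    qed simp
  qed simp
  \<comment> \<open>For fixed \<open>\<sigma>\<close>, left translation of \<open>\<tau>\<close>
    removes \<open>\<sigma>\<close> from the summand. The outer sum thus only contributes the group
    order, and the frame identity evaluates the inner one.\<close>
  also have "\<dots> = (\<Sum>\<sigma> | \<sigma> permutes X. \<Sum>\<tau> | \<tau> permutes X. bform u (?e \<tau>) * bform (?e \<tau>) v)"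
    by (subst sum.swap, rule sum.cong)
      (auto intro!: permutes_sum_left[where f = "\<lambda>\<tau>. bform u (?e \<tau>) * bform (?e \<tau>) v"] permutes_inv)
  also have "\<dots> = fact (card X) * bform u (\<Sum>\<tau> | \<tau> permutes X. cscale (bform (?e \<tau>) v) (?e \<tau>))"
    using finite_X by (simp add: card_permutations bform_sum bform_cscale mult.commute)
  also have "\<dots> = c * (fact (card X) * bform u v)"
    by (simp add: frame[OF v] bform_cscale)
  finally have kdim: "k * of_nat (cfun.dim M) = fact (card X) * bform u v"
    using c by simp
  have "of_nat (cfun.dim M) * T w x = fact (card X) * bform u v * w x"
    using kdim by (simp add: k[OF w] mult.assoc[symmetric] mult.commute[of _ k])
  then show ?thesis by (simp add: T_def sum_fun_apply)
qed

text \<open>Expand the character in the frame. For each frame vector, orthogonality with both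
  \<open>u\<close> and \<open>w\<close> equal to it evaluates the sum over the group, and the frame
  identity then reassembles \<open>v\<close>.\<close>

lemma character_sum_act:
  assumes v: "v \<in> M"
  shows "(\<Sum>\<sigma> | \<sigma> permutes X. specht_char X \<mu> \<sigma> * perm_act \<sigma> v x) =
    fact (card X) / of_nat (cfun.dim M) * v x"
proof -
  obtain t where t: "filling t" using ex_filling by auto
  obtain c where c: "c \<noteq> 0" and frame: "\<And>v. v \<in> M \<Longrightarrow>
      (\<Sum>\<tau> | \<tau> permutes X. cscale (bform (perm_act \<tau> (e t)) v) (perm_act \<tau> (e t))) = cscale c v"
    using tight_frame[OF t] by blast
  let ?e = "\<lambda>\<tau>. perm_act \<tau> (e t)"
  let ?d = "of_nat (cfun.dim M) :: complex"
  have eM: "?e \<tau> \<in> M" if "\<tau> permutes X" for \<tau>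
    using that t by (simp add: perm_act_specht polytabloid_in_specht)
  \<comment> \<open>Invariance and symmetry of \<open>bform\<close> trade \<open>\<sigma>\<close>
    for its inverse, the shape required by \<open>schur_orthogonality\<close>. Complex conjugation
    of the character would do this for a Hermitian form.\<close>
  have chi: "c * specht_char X \<mu> \<sigma> =
      (\<Sum>\<tau> | \<tau> permutes X. bform (?e \<tau>) (perm_act (Hilbert_Choice.inv \<sigma>) (?e \<tau>)))"
    if \<sigma>: "\<sigma> permutes X" for \<sigma>
  proof -
    have "c * specht_char X \<mu> \<sigma> = (\<Sum>\<tau> | \<tau> permutes X. bform (?e \<tau>) (perm_act \<sigma> (?e \<tau>)))"
      unfolding specht_char_def
      by (rule trace_on_frame[OF t c frame perm_act_hom]) (simp_all add: perm_act_specht \<sigma>)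
    then show ?thesis
      by (simp add: bform_perm[OF \<sigma>, symmetric] bform_commute)
  qed
  have "c * (?d * (\<Sum>\<sigma> | \<sigma> permutes X. specht_char X \<mu> \<sigma> * perm_act \<sigma> v x)) =
      ?d * (\<Sum>\<sigma> | \<sigma> permutes X. c * specht_char X \<mu> \<sigma> * perm_act \<sigma> v x)"
    by (simp add: sum_distrib_left mult_ac)
  also have "\<dots> = ?d * (\<Sum>\<sigma> | \<sigma> permutes X. \<Sum>\<tau> | \<tau> permutes X.
      bform (?e \<tau>) (perm_act (Hilbert_Choice.inv \<sigma>) (?e \<tau>)) * perm_act \<sigma> v x)"
    by (simp add: chi sum_distrib_right)
  also have "\<dots> = (\<Sum>\<tau> | \<tau> permutes X. ?d * (\<Sum>\<sigma> | \<sigma> permutes X.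
      bform (?e \<tau>) (perm_act (Hilbert_Choice.inv \<sigma>) (?e \<tau>)) * perm_act \<sigma> v x))"
    by (subst sum.swap) (simp add: sum_distrib_left)
  also have "\<dots> = (\<Sum>\<tau> | \<tau> permutes X. fact (card X) * bform (?e \<tau>) v * ?e \<tau> x)"
    by (rule sum.cong) (simp_all add: schur_orthogonality[OF v] eM)
  also have "\<dots> = fact (card X) * (\<Sum>\<tau> | \<tau> permutes X. cscale (bform (?e \<tau>) v) (?e \<tau>)) x"
    by (simp add: sum_fun_apply sum_distrib_left mult.assoc)
  also have "\<dots> = c * (fact (card X) * v x)"
    by (simp add: frame[OF v])
  finally show ?thesis
    using c dim_specht_pos by (simp add: field_simps)
qed

end

subsection \<open>The standard basis theorem\<close>

lemma sum_digits_less: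
  fixes r :: "nat \<Rightarrow> nat"
  assumes "S \<subseteq> {..<a}" and "\<And>b. b \<in> S \<Longrightarrow> r b < K" and "0 < K"
  shows "(\<Sum>b\<in>S. r b * K ^ b) < K ^ a"
proof -
  have "(\<Sum>b\<in>S. r b * K ^ b) \<le> (\<Sum>b\<in>S. (K - 1) * K ^ b)"
    by (intro sum_mono mult_right_mono) (use assms(2) in force)+
  also have "\<dots> \<le> (\<Sum>b<a. (K - 1) * K ^ b)"
    using assms(1) by (intro sum_mono2) auto
  also have "(\<Sum>b<a. (K - 1) * K ^ b) < K ^ a"
  proof (induction a)
    case (Suc a)
    have "(\<Sum>b<Suc a. (K - 1) * K ^ b) < K ^ a + (K - 1) * K ^ a"
      using Suc by simp
    also have "\<dots> = K ^ Suc a"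
      using \<open>0 < K\<close> by (cases K) auto
    finally show ?case .
  qed simp
  finally show ?thesis .
qed

text \<open>The highest differing digit decides: it contributes a gap of at least
  \<open>K ^ a\<close>, and the lower places of the smaller number stay below
  \<open>K ^ a\<close>.\<close>

lemma digits_less:
  fixes r r' :: "nat \<Rightarrow> nat"
  assumes "finite S" and "\<And>b. b \<in> S \<Longrightarrow> r b < K" and a: "a \<in> S" "r a < r' a"
    and above: "\<And>b. b \<in> S \<Longrightarrow> a < b \<Longrightarrow> r b = r' b"
  shows "(\<Sum>b\<in>S. r b * K ^ b) < (\<Sum>b\<in>S. r' b * K ^ b)"
proof -
  define L where "L = {b \<in> S. b < a}"
  define U where "U = {b \<in> S. a < b}"
  have S: "S = insert a (L \<union> U)" using a(1) by (auto simp: L_def U_def)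
  have fin: "finite L" "finite U" using assms(1) by (auto simp: L_def U_def)
  have split: "(\<Sum>b\<in>S. f b) = f a + ((\<Sum>b\<in>L. f b) + (\<Sum>b\<in>U. f b))" for f :: "nat \<Rightarrow> nat"
    unfolding S by (subst sum.insert, (use fin in \<open>auto simp: L_def U_def\<close>)[2],
      subst sum.union_disjoint) (use fin in \<open>auto simp: L_def U_def\<close>)
  have "(\<Sum>b\<in>L. r b * K ^ b) < K ^ a"
    using assms(2)[OF a(1)] assms(2) by (intro sum_digits_less) (auto simp: L_def)
  moreover have "(\<Sum>b\<in>U. r b * K ^ b) = (\<Sum>b\<in>U. r' b * K ^ b)"
    by (rule sum.cong) (auto simp: U_def above)
  moreover have "r a * K ^ a + K ^ a \<le> r' a * K ^ a"
    using mult_right_mono[of "Suc (r a)" "r' a" "K ^ a"] a(2) by simp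
  ultimately show ?thesis
    unfolding split by linarith
qed

text \<open>An increasing tuple is determined by its set of values. This recovers a sorted row from
  its tabloid and also gives uniqueness of the sorting permutation of a tuple.\<close>

lemma strict_mono_on_nth:
  fixes f :: "nat \<Rightarrow> nat"
  assumes "strict_mono_on {1..d} f" and "r \<in> {1..d}"
  shows "f r = sorted_list_of_set (f ` {1..d}) ! (r - 1)"
proof -
  define xs where "xs = map f [1..<Suc d]"
  have "sorted_wrt (<) xs"
    unfolding xs_def sorted_wrt_map
    by (rule sorted_wrt_mono_rel[OF _ sorted_wrt_upt])
      (use assms(1) in \<open>auto simp: strict_mono_on_def\<close>)
  moreover have "set xs = f ` {1..d}"
    by (force simp: xs_def)
  ultimately have "sorted_list_of_set (f ` {1..d}) = xs"
    by (metis sorted_list_of_set.idem_if_sorted_distinct strict_sorted_iff)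
  then show ?thesis
    using assms(2) by (cases r) (simp_all add: xs_def del: upt_Suc)
qed

context specht_module
begin

text \<open>The last letter order on tabloids (compare the rows of the largest entry lying in different
  rows), encoded as a number with the rows as digits.\<close>

definition weight :: "(nat \<Rightarrow> nat set) \<Rightarrow> nat" where
  "weight x = (\<Sum>a\<in>X. row x a * Suc (\<Sum>c\<in>D. fst c) ^ a)"

text \<open>The largest entry whose rows differ is the leading differing digit, so
  \<open>last\<close> asks for a comparison only at an entry above which the tabloids agree.\<close>

lemma weight_less:
  assumes x: "x \<in> tabloids" and y: "y \<in> tabloids" and "x \<noteq> y"
    and last: "\<And>a. a \<in> X \<Longrightarrow> row x a \<noteq> row y a \<Longrightarrow>
      (\<And>b. b \<in> X \<Longrightarrow> a < b \<Longrightarrow> row x b = row y b) \<Longrightarrow> row x a < row y a"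
  shows "weight x < weight y"
proof -
  define S where "S = {a \<in> X. row x a \<noteq> row y a}"
  have fin: "finite S" using finite_X by (simp add: S_def)
  have "S \<noteq> {}" using tabloid_eqI[OF x y] \<open>x \<noteq> y\<close> by (auto simp: S_def)
  define m where "m = Max S"
  have "m \<in> S" using Max_in[OF fin \<open>S \<noteq> {}\<close>] by (simp add: m_def)
  then have m: "m \<in> X" "row x m \<noteq> row y m" by (simp_all add: S_def)
  have above: "row x b = row y b" if "b \<in> X" "m < b" for b
  proof (rule ccontr)
    assume "row x b \<noteq> row y b"
    then have "b \<in> S" using that(1) by (simp add: S_def)
    then show False using Max_ge[OF fin, of b] that(2) by (simp add: m_def)
  qed
  \<comment> \<open>A row number is one of the summands, so the base in \<open>weight\<close>
    exceeds every digit.\<close>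
  have bound: "row x b < Suc (\<Sum>c\<in>D. fst c)" if bX: "b \<in> X" for b
  proof -
    obtain s where s: "filling s" "x = tabloid \<mu> s" using x by (rule tabloidsE)
    obtain c where c: "c \<in> D" "b = s c" using filling_surj[OF s(1) bX] by blast
    have "fst c \<le> (\<Sum>c\<in>D. fst c)" using c(1) finite_D by (intro member_le_sum) auto
    then show ?thesis using s c by (simp add: row_tabloid)
  qed
  have "row x m < row y m" using m above by (rule last)
  from finite_X bound m(1) this above show ?thesis
    unfolding weight_def by (rule digits_less)
qed

section \<open>Standard tableaux and triangularity of their polytabloids\<close>

definition row_increasing :: "(nat \<times> nat \<Rightarrow> nat) \<Rightarrow> bool" where
  "row_increasing t \<longleftrightarrow>
     (\<forall>i j j'. (i, j) \<in> D \<and> (i, j') \<in> D \<and> j < j' \<longrightarrow> t (i, j) < t (i, j'))"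

definition column_increasing :: "(nat \<times> nat \<Rightarrow> nat) \<Rightarrow> bool" where
  "column_increasing t \<longleftrightarrow>
     (\<forall>i i' j. (i, j) \<in> D \<and> (i', j) \<in> D \<and> i < i' \<longrightarrow> t (i, j) < t (i', j))"

definition std :: "(nat \<times> nat \<Rightarrow> nat) set" where
  "std = {t \<in> tableaux \<mu> X. row_increasing t \<and> column_increasing t}"

lemma finite_std: "finite std"
  using finite_tableaux by (simp add: std_def)

lemma std_filling: "t \<in> std \<Longrightarrow> filling t"
  by (simp add: std_def tableaux_filling)

lemma column_comp_mem:
  assumes \<pi>: "\<pi> \<in> column_stabilizer X \<mu> t" and c: "c \<in> D"
  obtains c' where "c' \<in> D" "snd c' = snd c" "t c = \<pi> (t c')"
proof -
  have "t c \<in> column t (snd c)" using c by (auto simp: column_def)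
  then have "t c \<in> \<pi> ` column t (snd c)" using \<pi> by (simp add: column_stabilizer_iff)
  then show ?thesis using that by (auto simp: column_def)
qed

text \<open>Suppose the largest entry a that changes row moved down. The entry of \<open>t\<close>
  in the cell it moves to is larger than a, hence keeps its row; as it also keeps its column,
  \<open>\<pi>\<close> fixes it. But \<open>\<pi>\<close> sends it to a.\<close>

lemma weight_column_stabilizer:
  assumes t: "filling t" "column_increasing t" and \<pi>: "\<pi> \<in> column_stabilizer X \<mu> t"
    and ne: "tabloid \<mu> (\<pi> \<circ> t) \<noteq> tabloid \<mu> t"
  shows "weight (tabloid \<mu> (\<pi> \<circ> t)) < weight (tabloid \<mu> t)"
proof (rule weight_less)
  have \<pi>t: "filling (\<pi> \<circ> t)"
    using t(1) column_stabilizer_permutes[OF \<pi>] by (rule filling_perm)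
  show "tabloid \<mu> (\<pi> \<circ> t) \<in> tabloids" "tabloid \<mu> t \<in> tabloids"
    using t \<pi>t by (simp_all add: tabloid_in)
  fix a assume a: "a \<in> X" and neq: "row (tabloid \<mu> (\<pi> \<circ> t)) a \<noteq> row (tabloid \<mu> t) a"
    and above: "\<And>b. b \<in> X \<Longrightarrow> a < b \<Longrightarrow> row (tabloid \<mu> (\<pi> \<circ> t)) b = row (tabloid \<mu> t) b"
  obtain c where c: "c \<in> D" "a = t c" using filling_surj[OF t(1) a] by blast
  obtain c' where c': "c' \<in> D" "snd c' = snd c" "t c = \<pi> (t c')"
    using column_comp_mem[OF \<pi> c(1)] by blast
  have r': "row (tabloid \<mu> (\<pi> \<circ> t)) a = fst c'"
    using row_tabloid[OF \<pi>t c'(1)] c c' by simp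
  have r: "row (tabloid \<mu> t) a = fst c"
    using row_tabloid[OF t(1) c(1)] c by simp
  have "fst c' < fst c"
  proof (rule ccontr)
    assume "\<not> fst c' < fst c"
    then have "fst c < fst c'" using neq r r' by simp
    then have ab: "a < t c'"
      using t(2) c c' unfolding column_increasing_def by (metis prod.collapse)
    have row_b: "row (tabloid \<mu> (\<pi> \<circ> t)) (t c') = fst c'"
      using above[OF filling_mem[OF t(1) c'(1)] ab] row_tabloid[OF t(1) c'(1)] by simp
    obtain c'' where c'': "c'' \<in> D" "snd c'' = snd c'" "t c' = \<pi> (t c'')"
      using column_comp_mem[OF \<pi> c'(1)] by blast
    have "row (tabloid \<mu> (\<pi> \<circ> t)) (t c') = fst c''"
      using row_tabloid[OF \<pi>t c''(1)] c'' by simp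
    then have "c'' = c'" using row_b c''(2) by (simp add: prod_eq_iff)
    then show False using ab c(2) c'(3) c''(3) by (metis less_irrefl)
  qed
  then show "row (tabloid \<mu> (\<pi> \<circ> t)) a < row (tabloid \<mu> t) a"
    by (simp add: r r')
qed (rule ne)

lemma polytabloid_nonzero:
  assumes "e t x \<noteq> 0"
  obtains \<pi> where "\<pi> \<in> column_stabilizer X \<mu> t" and "x = tabloid \<mu> (\<pi> \<circ> t)"
proof -
  obtain \<pi> where "\<pi> \<in> column_stabilizer X \<mu> t"
    "of_int (sign \<pi>) * (if tabloid \<mu> (\<pi> \<circ> t) = x then 1 else (0::complex)) \<noteq> 0"
    using assms unfolding polytabloid_def by (rule sum.not_neutral_contains_not_neutral)
  then show ?thesis using that by (auto split: if_splits)
qed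

lemma row_list:
  assumes t: "filling t" and inc: "row_increasing t" and j: "1 \<le> j" "j \<le> \<mu> i" and i: "1 \<le> i"
  shows "t (i, j) = sorted_list_of_set (tabloid \<mu> t i) ! (j - 1)"
proof -
  have D: "(i, j) \<in> D \<longleftrightarrow> 1 \<le> j \<and> j \<le> \<mu> i" for j using i by (auto simp: diagram_def)
  have "strict_mono_on {1..\<mu> i} (\<lambda>j. t (i, j))"
    using inc by (auto simp: strict_mono_on_def row_increasing_def D)
  then have "t (i, j) = sorted_list_of_set ((\<lambda>j. t (i, j)) ` {1..\<mu> i}) ! (j - 1)"
    using j by (intro strict_mono_on_nth) auto
  also have "(\<lambda>j. t (i, j)) ` {1..\<mu> i} = tabloid \<mu> t i"
    by (force simp: tabloid_def D)
  finally show ?thesis .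
qed

lemma std_eqI:
  assumes "s \<in> std" and "t \<in> std" and "tabloid \<mu> s = tabloid \<mu> t"
  shows "s = t"
proof
  fix c
  show "s c = t c"
  proof (cases "c \<in> D")
    case True
    obtain i j where c: "c = (i, j)" by (cases c)
    then have j: "1 \<le> i" "1 \<le> j" "j \<le> \<mu> i" using True by (auto simp: diagram_def)
    have "s (i, j) = sorted_list_of_set (tabloid \<mu> s i) ! (j - 1)"
      "t (i, j) = sorted_list_of_set (tabloid \<mu> t i) ! (j - 1)"
      using row_list[OF std_filling[OF assms(1)] _ j(2,3,1)]
        row_list[OF std_filling[OF assms(2)] _ j(2,3,1)] assms(1,2) by (auto simp: std_def)
    then show ?thesis using assms(3) c by simp
  next
    case False
    then show ?thesis
      using assms(1,2) extensional_arb[of s D c] extensional_arb[of t D c]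
      by (simp add: std_def tableaux_def)
  qed
qed

text \<open>Together with \<open>polytabloid_self\<close>, the matrix of values of standard
  polytabloids at standard tabloids is triangular with unit diagonal.\<close>

lemma polytabloid_std_weight:
  assumes "s \<in> std" and "t \<in> std" and "s \<noteq> t" and "e t (tabloid \<mu> s) \<noteq> 0"
  shows "weight (tabloid \<mu> s) < weight (tabloid \<mu> t)"
proof -
  obtain \<pi> where \<pi>: "\<pi> \<in> column_stabilizer X \<mu> t" "tabloid \<mu> s = tabloid \<mu> (\<pi> \<circ> t)"
    using polytabloid_nonzero[OF assms(4)] by blast
  have "tabloid \<mu> s \<noteq> tabloid \<mu> t" using std_eqI assms by blast
  then show ?thesis
    using weight_column_stabilizer[OF std_filling[OF assms(2)] _ \<pi>(1)] \<pi>(2) assms(2)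
    by (auto simp: std_def)
qed

lemma inj_polytabloid_std: "inj_on e std"
proof (rule inj_onI, rule ccontr)
  fix s t assume st: "s \<in> std" "t \<in> std" "e s = e t" "s \<noteq> t"
  have "e s (tabloid \<mu> t) \<noteq> 0" "e t (tabloid \<mu> s) \<noteq> 0"
    using polytabloid_self[OF std_filling] st by (metis zero_neq_one)+
  then show False
    using polytabloid_std_weight[of s t] polytabloid_std_weight[of t s] st by simp
qed

lemma independent_polytabloid_std: "cfun.independent (e ` std)"
proof
  assume "cfun.dependent (e ` std)"
  then obtain c where c: "\<exists>v\<in>e ` std. c v \<noteq> 0" "(\<Sum>v\<in>e ` std. cscale (c v) v) = 0"
    using cfun.dependent_finite[of "e ` std"] finite_std by auto
  define S where "S = {t \<in> std. c (e t) \<noteq> 0}"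
  have S: "finite S" "S \<noteq> {}" using c(1) finite_std by (auto simp: S_def)
  \<comment> \<open>Evaluate the relation at the tabloid of the heaviest tableau with nonzero
    coefficient: any other contributing term would be heavier still.\<close>
  define w where "w t = weight (tabloid \<mu> t)" for t
  have "Max (w ` S) \<in> w ` S" using S by simp
  then obtain s where s: "s \<in> S" "w s = Max (w ` S)" by auto
  have max: "w t \<le> w s" if "t \<in> S" for t
    using that S by (simp add: s(2))
  have sstd: "s \<in> std" using s(1) by (simp add: S_def)
  have "c (e t) * e t (tabloid \<mu> s) = (if t = s then c (e s) else 0)" if "t \<in> std" for t
  proof (cases "t = s")
    case True
    then show ?thesis using polytabloid_self[OF std_filling[OF that]] by simp
  next
    case False
    then show ?thesis
      using polytabloid_std_weight[OF sstd that] max[of t] that by (auto simp: S_def w_def)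
  qed
  then have "(\<Sum>t\<in>std. c (e t) * e t (tabloid \<mu> s)) = (\<Sum>t\<in>std. if t = s then c (e s) else 0)"
    by (intro sum.cong) auto
  also have "\<dots> = c (e s)" using finite_std sstd by simp
  also have "(\<Sum>t\<in>std. c (e t) * e t (tabloid \<mu> s)) = (\<Sum>v\<in>e ` std. cscale (c v) v) (tabloid \<mu> s)"
    by (simp add: sum_fun_apply sum.reindex[OF inj_polytabloid_std])
  finally show False using c(2) s(1) by (simp add: S_def)
qed

text \<open>Garnir relations, read as linear conditions on the values of the functions in the module. If
  the sum is not trivially zero, then \<open>Z\<close> lies in the first \<open>\<mu> i\<close> columns of the tableau.\<close>

lemma garnir:
  assumes v: "v \<in> M" and x: "x \<in> tabloids" and Z: "Z \<subseteq> X" and i: "1 \<le> i"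
    and rows: "\<And>z. z \<in> Z \<Longrightarrow> row x z = i \<or> row x z = Suc i" and card: "\<mu> i < card Z"
  shows "(\<Sum>h | h permutes Z. v (perm_image h x)) = 0"
  using v
proof (induction rule: specht_induct)
  case subspace
  show ?case
    by (auto simp: cfun.subspace_def sum.distrib simp flip: sum_distrib_left)
next
  case (polytabloid t)
  note t = polytabloid
  show ?case
  proof (cases "\<forall>h. h permutes Z \<longrightarrow> e t (perm_image h x) = 0")
    case True
    then show ?thesis by (intro sum.neutral) auto
  next
    case False
    then obtain g where g: "g permutes Z" "e t (perm_image g x) \<noteq> 0" by auto
    obtain \<pi> where \<pi>: "\<pi> \<in> column_stabilizer X \<mu> t" "perm_image g x = tabloid \<mu> (\<pi> \<circ> t)"
      using polytabloid_nonzero[OF g(2)] by blast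
    have gX: "g permutes X" using g(1) Z by (rule permutes_subset)
    have \<pi>t: "filling (\<pi> \<circ> t)"
      using t column_stabilizer_permutes[OF \<pi>(1)] by (rule filling_perm)
    \<comment> \<open>\<open>z\<close> lies in row \<open>i\<close> or \<open>Suc i\<close> of
      \<open>perm_image g x\<close>, and there it stands in the column that it has in
      \<open>t\<close>, since \<open>\<pi>\<close> preserves columns. So this column is at most
      \<open>\<mu> i\<close>.\<close>
    have col: "\<exists>c\<in>D. z = t c \<and> snd c \<in> {1..\<mu> i}" if z: "z \<in> Z" for z
    proof -
      have zX: "z \<in> X" using z Z by auto
      obtain c where c: "c \<in> D" "z = t c" using filling_surj[OF t zX] by blast
      obtain c' where c': "c' \<in> D" "snd c' = snd c" "t c = \<pi> (t c')"
        using column_comp_mem[OF \<pi>(1) c(1)] by blast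
      have "fst c' = row (perm_image g x) z"
        using row_tabloid[OF \<pi>t c'(1)] c c' \<pi>(2) by simp
      also have "\<dots> = row x (Hilbert_Choice.inv g z)"
        using x gX zX by (rule row_perm_image)
      finally have "fst c' = i \<or> fst c' = Suc i"
        using rows[of "Hilbert_Choice.inv g z"] z g(1) by (simp add: permutes_in_image permutes_inv)
      then have "\<mu> (fst c') \<le> \<mu> i" using partition_antimono[OF part i] by auto
      then have "snd c \<in> {1..\<mu> i}" using c'(1,2) by (auto simp: diagram_def)
      then show ?thesis using c by blast
    qed
    then obtain p where p: "\<And>z. z \<in> Z \<Longrightarrow> p z \<in> D \<and> z = t (p z) \<and> snd (p z) \<in> {1..\<mu> i}"
      by metis
    \<comment> \<open>More than \<open>\<mu> i\<close> entries in \<open>\<mu> i\<close> columns: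
      two of them share a column of \<open>t\<close>. Their transposition permutes \<open>Z\<close>
      and negates \<open>e t\<close>, so the sum equals its own negative.\<close>
    have "card ((\<lambda>z. snd (p z)) ` Z) \<le> card {1..\<mu> i}"
      using p by (intro card_mono) auto
    then have "\<not> inj_on (\<lambda>z. snd (p z)) Z"
      using card by (intro pigeonhole) simp
    then obtain z z' where z: "z \<in> Z" "z' \<in> Z" "z \<noteq> z'" "snd (p z) = snd (p z')"
      by (auto simp: inj_on_def)
    define \<tau> where "\<tau> = transpose z z'"
    have "\<tau> \<in> column_stabilizer X \<mu> t"
      using transpose_column_stabilizer[OF t, of "p z" "p z'"] p z by (simp add: \<tau>_def)
    then have anti: "perm_act \<tau> (e t) y = - e t y" for y
      using z(3) by (simp add: perm_act_column_stabilizer \<tau>_def sign_swap_id)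
    have \<tau>: "\<tau> permutes Z" using z by (simp add: \<tau>_def permutes_swap_id)
    have "(\<Sum>h | h permutes Z. e t (perm_image h x)) = (\<Sum>h | h permutes Z. e t (perm_image (\<tau> \<circ> h) x))"
      by (rule permutes_sum_left[OF \<tau>, symmetric])
    also have "\<dots> = (\<Sum>h | h permutes Z. - e t (perm_image h x))"
      by (simp add: anti[symmetric] perm_act_apply perm_image_comp \<tau>_def)
    finally show ?thesis by (simp add: sum_negf)
  qed
qed

lemma row_sorted_tableau:
  assumes x: "x \<in> tabloids"
  obtains t where "t \<in> tableaux \<mu> X" and "row_increasing t" and "tabloid \<mu> t = x"
proof -
  obtain s where s: "filling s" "x = tabloid \<mu> s" using x by (rule tabloidsE)
  have fin: "finite (x i)" for i
    using s(2) finite_D by (simp add: tabloid_def)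
  have card: "card (x i) = \<mu> i" if "1 \<le> i" for i
  proof -
    have "card (x i) = card {c \<in> D. fst c = i}"
      unfolding s(2) tabloid_def by (rule card_image) (auto simp: inj_on_def filling_inj[OF s(1)])
    also have "{c \<in> D. fst c = i} = Pair i ` {1..\<mu> i}"
      using that by (auto simp: diagram_def)
    finally show ?thesis by (simp add: card_image inj_on_def)
  qed
  define xs where "xs i = sorted_list_of_set (x i)" for i
  have len: "length (xs i) = \<mu> i" if "1 \<le> i" for i
    using card[OF that] by (simp add: xs_def)
  define t where "t = (\<lambda>c\<in>D. xs (fst c) ! (snd c - 1))"
  have mem: "t c \<in> x (fst c)" if "c \<in> D" for c
  proof -
    have "snd c - 1 < length (xs (fst c))" using that len by (auto simp: diagram_def)
    then have "t c \<in> set (xs (fst c))" using that by (simp add: t_def)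
    then show ?thesis using fin by (simp add: xs_def)
  qed
  have inc: "row_increasing t"
    unfolding row_increasing_def
  proof (intro allI impI)
    fix i j j' assume d: "(i, j) \<in> D \<and> (i, j') \<in> D \<and> j < j'"
    then have "j - 1 < j' - 1" "j' - 1 < length (xs i)" using len by (auto simp: diagram_def)
    then have "xs i ! (j - 1) < xs i ! (j' - 1)"
      unfolding xs_def by (intro sorted_wrt_nth_less[where P = "(<)"]) auto
    then show "t (i, j) < t (i, j')" using d by (simp add: t_def)
  qed
  have "inj_on t D"
  proof (rule inj_onI)
    fix c c' assume c: "c \<in> D" "c' \<in> D" "t c = t c'"
    have "fst c = row x (t c)" "fst c' = row x (t c')"
      using mem[OF c(1)] mem[OF c(2)] mem_iff_row[OF x] by auto
    then have "fst c = fst c'" using c(3) by simp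
    then show "c = c'"
      using inc c unfolding row_increasing_def
      by (metis less_irrefl linorder_neqE_nat prod.collapse)
  qed
  moreover have "t ` D \<subseteq> X"
    using mem mem_iff_row[OF x] by auto
  moreover have "card D = card X" by (simp add: card_X psize_def)
  ultimately have "bij_betw t D X"
    unfolding bij_betw_def using finite_X by (metis card_image card_subset_eq)
  then have t: "t \<in> tableaux \<mu> X" by (simp add: tableaux_def t_def)
  have "tabloid \<mu> t = x"
  proof (rule tabloid_eqI[OF tabloid_in[OF tableaux_filling[OF t]] x])
    fix a assume a: "a \<in> X"
    obtain c where c: "c \<in> D" "a = t c" using filling_surj[OF tableaux_filling[OF t] a] by blast
    then show "row (tabloid \<mu> t) a = row x a"
      using row_tabloid[OF tableaux_filling[OF t] c(1)] mem[OF c(1)] mem_iff_row[OF x] by simp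
  qed
  then show ?thesis using t inc that by blast
qed

text \<open>The cells between two cells of a column belong to the diagram, so increase at all
  adjacent pairs would propagate to the whole column.\<close>

lemma column_descent:
  assumes t: "filling t" and "\<not> column_increasing t"
  obtains i c where "(i, c) \<in> D" and "(Suc i, c) \<in> D" and "t (Suc i, c) < t (i, c)"
proof (rule ccontr)
  assume contr: "\<not> thesis"
  note descent = that
  have adj: "t (i, c) < t (Suc i, c)" if "(i, c) \<in> D" "(Suc i, c) \<in> D" for i c
    using that filling_inj[OF t that] descent[OF that] contr
    by (metis Pair_inject linorder_neqE_nat n_not_Suc_n)
  have "t (i, j) < t (i', j)" if "(i, j) \<in> D" "i < i'" "(i', j) \<in> D" for i i' j
    using that(2,1,3)
  proof (induction rule: strict_inc_induct)
    case (base i)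
    then show ?case using adj by simp
  next
    case (step i)
    have "1 \<le> j" "j \<le> \<mu> i'" using step.prems by (auto simp: diagram_def)
    moreover have "\<mu> i' \<le> \<mu> (Suc i)"
      using step.hyps partition_antimono[OF part, of "Suc i" i'] by simp
    ultimately have "(Suc i, j) \<in> D" by (auto simp: diagram_def)
    then show ?case using step adj[of i j] by fastforce
  qed
  then show False using assms(2) by (auto simp: column_increasing_def)
qed

text \<open>Straightening: the Garnir relation at a column descent expresses the value at a tabloid by
  values at tabloids of larger weight.\<close>

lemma specht_vanish:
  assumes v: "v \<in> M" and zero: "\<And>t. t \<in> std \<Longrightarrow> v (tabloid \<mu> t) = 0"
  shows "v = 0"
proof (rule ccontr)
  assume "v \<noteq> 0"
  define S where "S = {x \<in> tabloids. v x \<noteq> 0}"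
  have S: "finite S" "S \<noteq> {}"
    using \<open>v \<noteq> 0\<close> specht_supp[OF v] finite_tabloids by (auto simp: S_def fun_eq_iff)
  have "Max (weight ` S) \<in> weight ` S" using S by simp
  then obtain x where xS: "x \<in> S" "weight x = Max (weight ` S)" by auto
  have max: "v y = 0" if "y \<in> tabloids" "weight x < weight y" for y
  proof (rule ccontr)
    assume "v y \<noteq> 0"
    then have "weight y \<le> weight x" using that(1) S by (simp add: xS(2) S_def)
    then show False using that(2) by simp
  qed
  have x: "x \<in> tabloids" and vx: "v x \<noteq> 0" using xS(1) by (auto simp: S_def)
  obtain t where t: "t \<in> tableaux \<mu> X" "row_increasing t" "tabloid \<mu> t = x"
    using row_sorted_tableau[OF x] by blast
  have tf: "filling t" using t(1) by (rule tableaux_filling)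
  have "\<not> column_increasing t" using zero[of t] t vx by (auto simp: std_def)
  then obtain i c where ic: "(i, c) \<in> D" "(Suc i, c) \<in> D" "t (Suc i, c) < t (i, c)"
    using column_descent[OF tf] by blast
  have c: "1 \<le> i" "1 \<le> c" "c \<le> \<mu> i" "c \<le> \<mu> (Suc i)" using ic by (auto simp: diagram_def)
  \<comment> \<open>The Garnir set at a descent: row \<open>i\<close> from column \<open>c\<close>
    on, row \<open>Suc i\<close> up to column \<open>c\<close>, together \<open>\<mu> i + 1\<close>
    cells. Increasing rows and the descent make every entry of \<open>L\<close> smaller than every
    entry of \<open>U\<close>.\<close>
  define CU where "CU = Pair i ` {c..\<mu> i}"
  define CL where "CL = Pair (Suc i) ` {1..c}"
  have CD: "CU \<subseteq> D" "CL \<subseteq> D" using c by (auto simp: CU_def CL_def diagram_def)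
  define U where "U = t ` CU"
  define L where "L = t ` CL"
  have fin: "finite U" "finite L" by (auto simp: U_def L_def CU_def CL_def)
  have inj: "inj_on t (CU \<union> CL)"
    using CD filling_inj[OF tf] by (meson inj_onI subset_iff sup.boundedI)
  have rowU: "row x a = i" if "a \<in> U" for a
    using that CD(1) row_tabloid[OF tf] t(3) by (force simp: U_def CU_def)
  have rowL: "row x a = Suc i" if "a \<in> L" for a
    using that CD(2) row_tabloid[OF tf] t(3) by (force simp: L_def CL_def)
  have "CU \<inter> CL = {}" by (auto simp: CU_def CL_def)
  then have "card (U \<union> L) = card CU + card CL"
    unfolding U_def L_def image_Un[symmetric] card_image[OF inj]
    by (rule card_Un_disjoint[rotated 2]) (auto simp: CU_def CL_def)
  also have "\<dots> = \<mu> i - c + 1 + c"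
    using c by (simp add: CU_def CL_def card_image inj_on_def)
  finally have cardZ: "\<mu> i < card (U \<union> L)" using c by simp
  have Z: "U \<union> L \<subseteq> X" using CD filling_mem[OF tf] by (auto simp: U_def L_def)
  have LU: "a < b" if aL: "a \<in> L" and bU: "b \<in> U" for a b
  proof -
    obtain j where j: "1 \<le> j" "j \<le> c" "a = t (Suc i, j)" using aL by (auto simp: L_def CL_def)
    obtain j' where j': "c \<le> j'" "j' \<le> \<mu> i" "b = t (i, j')" using bU by (auto simp: U_def CU_def)
    have "(Suc i, j) \<in> D" "(i, j') \<in> D" using j j' c by (auto simp: diagram_def)
    then have "t (Suc i, j) \<le> t (Suc i, c)" "t (i, c) \<le> t (i, j')"
      using t(2) ic j j' unfolding row_increasing_def by (metis le_less)+
    then show ?thesis using ic j j' by simp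
  qed
  have heavier: "weight x < weight (perm_image h x)" if h: "h permutes U \<union> L" and ne: "perm_image h x \<noteq> x" for h
  proof (rule weight_less)
    have hX: "h permutes X" using h Z by (rule permutes_subset)
    show "x \<in> tabloids" "perm_image h x \<in> tabloids" "x \<noteq> perm_image h x"
      using x hX ne by (auto simp: perm_image_tabloids)
    have row: "row (perm_image h x) a = row x (Hilbert_Choice.inv h a)" if "a \<in> X" for a
      using x hX that by (rule row_perm_image)
    fix a assume a: "a \<in> X" and neq: "row x a \<noteq> row (perm_image h x) a"
      and above: "\<And>b. b \<in> X \<Longrightarrow> a < b \<Longrightarrow> row x b = row (perm_image h x) b"
    have "a \<in> U \<union> L"
    proof (rule ccontr)
      assume "a \<notin> U \<union> L"
      then have "Hilbert_Choice.inv h a = a" using permutes_inv[OF h] by (rule permutes_not_in[rotated])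
      then show False using neq row[OF a] by simp
    qed
    then have inv: "Hilbert_Choice.inv h a \<in> U \<union> L" using permutes_in_image[OF permutes_inv[OF h]] by blast
    show "row x a < row (perm_image h x) a"
    proof (cases "a \<in> U")
      case True
      then show ?thesis using inv neq rowU rowL row[OF a] by (metis UnE lessI)
    next
      case False
      then have aL: "a \<in> L" using \<open>a \<in> U \<union> L\<close> by simp
      then have ra: "row (perm_image h x) a = i"
        using inv neq rowU rowL row[OF a] by (metis UnE)
      \<comment> \<open>If the largest entry a that changes row came from \<open>L\<close>, it moved
        up to row \<open>i\<close>. All of \<open>U\<close> is larger than a and so remains in row
        \<open>i\<close>, which leaves more entries there than \<open>U\<close> can supply.\<close>
      have "insert a U \<subseteq> h ` U"
      proof
        fix b assume b: "b \<in> insert a U"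
        then have bZ: "b \<in> U \<union> L" and bX: "b \<in> X" using aL Z by auto
        have "row (perm_image h x) b = i"
          using b ra above[OF bX] LU[OF aL, of b] rowU[of b] by auto
        moreover have "Hilbert_Choice.inv h b \<in> U \<union> L"
          using permutes_in_image[OF permutes_inv[OF h]] bZ by blast
        ultimately have "Hilbert_Choice.inv h b \<in> U"
          using row[OF bX] rowL by fastforce
        then show "b \<in> h ` U" using permutes_inverses(1)[OF h] by (metis image_eqI)
      qed
      then have "card (insert a U) \<le> card (h ` U)"
        using fin by (intro card_mono) auto
      also have "\<dots> \<le> card U" using fin(1) by (rule card_image_le)
      finally show ?thesis using False fin by simp
    qed
  qed
  have "(\<Sum>h | h permutes U \<union> L. v (perm_image h x)) = 0"
    using v x Z c(1) _ cardZ by (rule garnir) (auto simp: rowU rowL)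
  \<comment> \<open>The other tabloids are heavier than \<open>x\<close>, where \<open>v\<close>
    vanishes by maximality. What remains of the Garnir sum is \<open>v x\<close> times the number of
    \<open>h\<close> fixing \<open>x\<close>, and \<open>id\<close> is one of them.\<close>
  moreover have "v (perm_image h x) = (if perm_image h x = x then v x else 0)" if "h permutes U \<union> L" for h
    using heavier[OF that] max[OF perm_image_tabloids[OF x permutes_subset[OF that Z]]] by auto
  ultimately have "(\<Sum>h | h permutes U \<union> L. if perm_image h x = x then v x else 0) = 0"
    by simp
  moreover have finP: "finite {h. h permutes U \<union> L}"
    using fin by (intro finite_permutations) auto
  ultimately have "of_nat (card {h. h permutes U \<union> L \<and> perm_image h x = x}) * v x = 0"
    by (simp add: sum.If_cases Int_def)
  moreover have "id \<in> {h. h permutes U \<union> L \<and> perm_image h x = x}"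
    by (simp add: permutes_id)
  then have "card {h. h permutes U \<union> L \<and> perm_image h x = x} \<noteq> 0"
    using finP by (metis (no_types, lifting) card_0_eq empty_iff mem_Collect_eq rev_finite_subset subsetI)
  ultimately show False using vx by simp
qed

text \<open>Independence of the standard polytabloids bounds the dimension from below. From above,
  restriction to the standard tabloids is injective by \<open>specht_vanish\<close>, with image in
  the span of their indicator functions.\<close>

lemma dim_specht_std: "cfun.dim M = card std"
proof -
  obtain B where B: "cfun.independent B" "cfun.span B = M" "finite B"
    by (rule trace_on_basis) (rule that)
  have dim: "cfun.dim M = card B" using B(2,1) by (rule dim_specht)
  have "e ` std \<subseteq> cfun.span B"
    using B(2) polytabloid_in_specht std_filling by auto
  then have "card (e ` std) \<le> card B"
    using cfun.independent_span_bound[OF B(3) independent_polytabloid_std] by simp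
  then have lower: "card std \<le> cfun.dim M"
    by (simp add: dim card_image inj_polytabloid_std)
  define T where "T = tabloid \<mu> ` std"
  define ev where "ev v = (\<lambda>x. if x \<in> T then v x else (0::complex))" for v
  define \<Delta> where "\<Delta> = (\<lambda>x y. if y = x then 1 else (0::complex)) ` T"
  have finT: "finite T" using finite_std by (simp add: T_def)
  have fin\<Delta>: "finite \<Delta>" using finT by (simp add: \<Delta>_def)
  have hom: "module_hom cscale cscale ev"
    by (rule cscale_homI) (auto simp: ev_def fun_eq_iff)
  have "inj_on ev M"
  proof (rule inj_onI)
    fix u v assume uv: "u \<in> M" "v \<in> M" "ev u = ev v"
    have "u - v = 0"
    proof (rule specht_vanish)
      show "u - v \<in> M" using uv unfolding specht_def by (intro cfun.span_diff)
      fix t assume "t \<in> std"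
      then show "(u - v) (tabloid \<mu> t) = 0"
        using fun_cong[OF uv(3), of "tabloid \<mu> t"] by (simp add: ev_def T_def)
    qed
    then show "u = v" by simp
  qed
  then have "cfun.independent (ev ` B)"
    using module_hom.independent_injective_image[OF hom B(1)] B(2) by simp
  moreover have "ev ` B \<subseteq> cfun.span \<Delta>"
  proof
    fix f assume "f \<in> ev ` B"
    then obtain v where f: "f = ev v" by auto
    have "f = (\<Sum>x\<in>T. cscale (v x) (\<lambda>y. if y = x then 1 else 0))"
      using finT by (intro ext) (simp add: f ev_def sum_fun_apply if_distrib cong: if_cong)
    also have "\<dots> \<in> cfun.span \<Delta>"
      by (intro cfun.span_sum cfun.span_scale cfun.span_base) (simp add: \<Delta>_def)
    finally show "f \<in> cfun.span \<Delta>" .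
  qed
  ultimately have "card (ev ` B) \<le> card \<Delta>"
    using cfun.independent_span_bound[OF fin\<Delta>] by blast
  moreover have "inj_on ev B"
    using \<open>inj_on ev M\<close> cfun.span_superset[of B] unfolding B(2) by (rule inj_on_subset)
  moreover have "card \<Delta> \<le> card std"
    unfolding \<Delta>_def T_def image_image by (rule card_image_le[OF finite_std])
  ultimately have "cfun.dim M \<le> card std" by (simp add: dim card_image)
  with lower show ?thesis by simp
qed

end

theorem dim_specht_num_SYT:
  assumes "is_partition \<mu>"
  shows "cfun.dim (specht {1..psize \<mu>} \<mu>) = num_SYT \<mu>"
proof -
  interpret specht_module "{1..psize \<mu>}" \<mu>
    using assms by unfold_locales auto
  have "std = standard_tableaux \<mu>"
    unfolding std_def standard_tableaux_def row_increasing_def column_increasing_def ..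
  then show ?thesis using dim_specht_std unfolding num_SYT_def by simp
qed

subsection \<open>Pluecker coordinates and the reduced basis\<close>

text \<open>By size, only the full set contributes to \<open>beta\<close>, so it acts as the sum of
  character times group element. A nonzero vector of \<open>E\<close> makes the scalar unique, which
  the description in \<open>beta_E\<close> requires.\<close>

lemma beta_scalar:
  assumes "is_partition \<nu>" and "psize \<nu> = n"
    and "is_eigenspace (specht {1..n} \<nu>) (bethe_image n z \<nu>) E"
  shows "beta_E n z E \<nu> = fact n / of_nat (num_SYT \<nu>)" and "num_SYT \<nu> \<noteq> 0"
proof -
  interpret specht_module "{1..n}" \<nu>
    using assms by unfold_locales auto
  have dim: "cfun.dim (specht {1..n} \<nu>) = num_SYT \<nu>"
    using dim_specht_num_SYT[OF assms(1)] assms(2) by simp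
  then show "num_SYT \<nu> \<noteq> 0" using dim_specht_pos by simp
  have E: "cfun.subspace E" "E \<subseteq> specht {1..n} \<nu>" "E \<noteq> {0}"
    using assms(3) by (auto simp: is_eigenspace_def)
  then obtain w where w: "w \<in> E" "w \<noteq> 0"
    using cfun.subspace_0 by blast
  have b: "beta n z \<nu> 0 \<sigma> = specht_char {1..n} \<nu> \<sigma>" if "\<sigma> permutes {1..n}" for \<sigma>
  proof -
    have "Y = {1..n}" if "Y \<subseteq> {1..n}" "card Y = n" for Y
      using that by (intro card_subset_eq) auto
    then have "{Y. Y \<subseteq> {1..n} \<and> card Y = psize \<nu> \<and> \<sigma> permutes Y} = {{1..n}}"
      using that assms(2) by auto
    then show ?thesis by (simp add: beta_def)
  qed
  have act: "galg_act n (beta n z \<nu> 0) v = cscale (fact n / of_nat (num_SYT \<nu>)) v" if "v \<in> E" for v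
  proof
    fix x
    have "galg_act n (beta n z \<nu> 0) v x =
        (\<Sum>\<sigma> | \<sigma> permutes {1..n}. specht_char {1..n} \<nu> \<sigma> * perm_act \<sigma> v x)"
      unfolding galg_act_def by (rule sum.cong) (auto simp: b)
    also have "\<dots> = fact (card {1..n}) / of_nat (cfun.dim (specht {1..n} \<nu>)) * v x"
      using that E(2) by (intro character_sum_act) auto
    finally show "galg_act n (beta n z \<nu> 0) v x = cscale (fact n / of_nat (num_SYT \<nu>)) v x"
      by (simp only: dim cscale_apply card_atLeastAtMost diff_Suc_1)
  qed
  show "beta_E n z E \<nu> = fact n / of_nat (num_SYT \<nu>)"
    unfolding beta_E_def
  proof (rule the_equality)
    fix c assume "\<forall>v\<in>E. galg_act n (beta n z \<nu> 0) v = cscale c v"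
    then have "cscale c w = cscale (fact n / of_nat (num_SYT \<nu>)) w"
      by (metis act w(1))
    then show "c = fact n / of_nat (num_SYT \<nu>)"
      using w(2) by (metis cfun.scale_cancel_right)
  qed (use act in blast)
qed

text \<open>Justifies the definite description in \<open>beta_tuple\<close>.\<close>

lemma sorting_permutation:
  fixes I :: "nat \<Rightarrow> nat"
  assumes inj: "inj_on I {1..d}"
  shows "\<exists>!\<sigma>. \<sigma> permutes {1..d} \<and> strict_mono_on {1..d} (I \<circ> \<sigma>)"
proof -
  define xs where "xs = sorted_list_of_set (I ` {1..d})"
  have len: "length xs = d" using inj by (simp add: xs_def card_image)
  have nth: "xs ! (r - 1) \<in> I ` {1..d}" if "r \<in> {1..d}" for r
  proof -
    have "xs ! (r - 1) \<in> set xs" using that len by (intro nth_mem) auto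
    then show ?thesis by (simp add: xs_def)
  qed
  define \<sigma> where "\<sigma> r = (if r \<in> {1..d} then inv_into {1..d} I (xs ! (r - 1)) else r)" for r
  have I\<sigma>: "I (\<sigma> r) = xs ! (r - 1)" if "r \<in> {1..d}" for r
    using nth[OF that] that by (simp add: \<sigma>_def f_inv_into_f)
  have mono: "strict_mono_on {1..d} (I \<circ> \<sigma>)"
  proof (rule strict_mono_onI)
    fix r s assume rs: "r \<in> {1..d}" "s \<in> {1..d}" "r < s"
    then have "xs ! (r - 1) < xs ! (s - 1)"
      using len by (intro sorted_wrt_nth_less[where P = "(<)"]) (auto simp: xs_def)
    then show "(I \<circ> \<sigma>) r < (I \<circ> \<sigma>) s" using rs by (simp add: I\<sigma>)
  qed
  have "\<sigma> ` {1..d} \<subseteq> {1..d}"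
    using nth inv_into_into[of _ I "{1..d}"] by (auto simp: \<sigma>_def simp del: atLeastAtMost_iff)
  moreover have "inj_on \<sigma> {1..d}"
    using strict_mono_on_imp_inj_on[OF mono] by (rule inj_on_imageI2)
  ultimately have "bij_betw \<sigma> {1..d} {1..d}"
    by (simp add: bij_betw_def endo_inj_surj)
  then have perm: "\<sigma> permutes {1..d}"
    by (rule bij_imp_permutes) (auto simp: \<sigma>_def)
  show ?thesis
  proof (rule ex1I[of _ \<sigma>])
    fix \<tau> assume \<tau>: "\<tau> permutes {1..d} \<and> strict_mono_on {1..d} (I \<circ> \<tau>)"
    show "\<tau> = \<sigma>"
    proof
      fix r
      show "\<tau> r = \<sigma> r"
      proof (cases "r \<in> {1..d}")
        case True
        have "(I \<circ> \<tau>) ` {1..d} = I ` {1..d}"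
          using \<tau> permutes_image by (metis image_comp)
        then have "I (\<tau> r) = xs ! (r - 1)"
          using strict_mono_on_nth[of d "I \<circ> \<tau>" r] \<tau> True by (simp add: xs_def)
        then show ?thesis
          using inj I\<sigma>[OF True] True \<tau> perm permutes_in_image by (metis inj_onD)
      next
        case False
        then show ?thesis using \<tau> perm permutes_not_in[OF _ False] by metis
      qed
    qed
  qed (use perm mono in blast)
qed

section \<open>Minors of coordinate matrices\<close>

lemma coord_sum: "coord (\<Sum>i\<in>A. f i) j = (\<Sum>i\<in>A. coord (f i) j)"
  by (simp add: coord_def coeff_sum sum_distrib_left)

lemma coord_smult: "coord (smult c p) j = c * coord p j"
  by (simp add: coord_def)

lemma coord_diff: "coord (p - q) j = coord p j - coord q j"
  by (simp add: coord_def algebra_simps)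

lemma plucker_minor_permute:
  assumes \<sigma>: "\<sigma> permutes {1..d}"
  shows "plucker_minor d g (I \<circ> \<sigma>) = of_int (sign \<sigma>) * plucker_minor d g I"
proof -
  \<comment> \<open>Matrix indices start at 0, tuples at 1: \<open>p\<close> is
    \<open>\<sigma>\<close> shifted accordingly.\<close>
  define p where "p = map_permutation {1..d} (\<lambda>i. i - 1) \<sigma>"
  have bij: "bij_betw (\<lambda>i. i - 1) {1..d} {0..<d}"
    by (rule bij_betwI[where g = Suc]) auto
  then have inj: "inj_on (\<lambda>i. i - 1) {1..d}" by (rule bij_betw_imp_inj_on)
  have p: "p permutes {0..<d}"
    unfolding p_def using bij \<sigma> by (rule map_permutation_permutes)
  have sgn: "sign p = sign \<sigma>"
    unfolding p_def using inj \<sigma> by (rule sign_map_permutation) simp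
  have Suc_p: "Suc (p r) = \<sigma> (Suc r)" if "r < d" for r
  proof -
    have "p (Suc r - 1) = \<sigma> (Suc r) - 1"
      unfolding p_def using that by (intro map_permutation_apply[OF inj]) auto
    moreover have "\<sigma> (Suc r) \<in> {1..d}"
      using that by (simp only: permutes_in_image[OF \<sigma>]) auto
    ultimately show ?thesis by auto
  qed
  \<comment> \<open>The tuple indexes columns, while \<open>det_permute_rows\<close> speaks of
    rows.\<close>
  have T: "plucker_minor d g I = det (mat d d (\<lambda>(r, s). coord (g (Suc s)) (I (Suc r))))" for I
    unfolding plucker_minor_def
    by (subst det_transpose[of _ d, symmetric]) (auto intro!: arg_cong[where f = det])
  let ?A = "mat d d (\<lambda>(r, s). coord (g (Suc s)) (I (Suc r)))"
  have "plucker_minor d g (I \<circ> \<sigma>) = det (mat d d (\<lambda>(r, s). ?A $$ (p r, s)))"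
    unfolding T
  proof (rule arg_cong[where f = det], rule eq_matI)
    fix r s assume "r < dim_row (mat d d (\<lambda>(r, s). ?A $$ (p r, s)))"
      "s < dim_col (mat d d (\<lambda>(r, s). ?A $$ (p r, s)))"
    then have rs: "r < d" "s < d" by auto
    then have "p r < d" using permutes_in_image[OF p, of r] by simp
    then show "mat d d (\<lambda>(r, s). coord (g (Suc s)) ((I \<circ> \<sigma>) (Suc r))) $$ (r, s) =
        mat d d (\<lambda>(r, s). ?A $$ (p r, s)) $$ (r, s)"
      using rs by (simp add: Suc_p)
  qed auto
  also have "\<dots> = of_int (sign p) * det ?A"
    by (subst det_permute_rows[OF _ p]) auto
  finally show ?thesis by (simp add: sgn T)
qed

lemma plucker_minor_not_inj:
  assumes "\<not> inj_on I {1..d}"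
  shows "plucker_minor d g I = 0"
proof -
  obtain i j where ij: "i \<in> {1..d}" "j \<in> {1..d}" "I i = I j" "i \<noteq> j"
    using assms by (auto simp: inj_on_def)
  show ?thesis
    unfolding plucker_minor_def
    by (rule det_identical_columns[of _ d "i - 1" "j - 1"]) (use ij in \<open>auto simp: col_def\<close>)
qed

lemma det_zero_row:
  fixes A :: "'a :: comm_ring_1 mat"
  assumes "A \<in> carrier_mat n n" and "i < n" and "\<And>j. j < n \<Longrightarrow> A $$ (i, j) = 0"
  shows "det A = 0"
  using laplace_expansion_row[OF assms(1,2)] assms(3) by simp

text \<open>All columns but the last are unit vectors, the one for \<open>J s\<close> being absent.
  Expanding along the last column leaves the row of \<open>g s\<close>, with an identity matrix as
  complementary minor.\<close>

lemma plucker_minor_replace_last: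
  assumes s: "s \<in> {1..d}"
    and dual: "\<And>i j. i \<in> {1..d} \<Longrightarrow> j \<in> {1..d} \<Longrightarrow> coord (g i) (J j) = (if i = j then 1 else 0)"
  shows "plucker_minor d g (replace_last d J s k) = (- 1) ^ (d - s) * coord (g s) k"
proof -
  define A where "A = mat d d (\<lambda>(r, c). coord (g (Suc r)) (replace_last d J s k (Suc c)))"
  have A: "A \<in> carrier_mat d d" by (simp add: A_def)
  have d: "d - 1 < d" using s by auto
  have last: "A $$ (i, d - 1) = coord (g (Suc i)) k" if "i < d" for i
    using that s by (auto simp: A_def replace_last_def)
  have other: "A $$ (i, j) = (if Suc i = (if Suc j < s then Suc j else Suc (Suc j)) then 1 else 0)"
    if "i < d" "j < d - 1" for i j
    using that s dual[of "Suc i" "Suc j"] dual[of "Suc i" "Suc (Suc j)"]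
    by (auto simp: A_def replace_last_def)
  have cof: "cofactor A i (d - 1) = (if i = s - 1 then (- 1) ^ (d - s) else 0)" if i: "i < d" for i
  proof -
    let ?B = "mat_delete A i (d - 1)"
    have B: "?B \<in> carrier_mat (d - 1) (d - 1)" using A by (rule mat_delete_carrier)
    have entry: "?B $$ (r, c) = A $$ (if r < i then r else Suc r, c)" if "r < d - 1" "c < d - 1" for r c
      using that A by (simp add: mat_delete_def)
    show ?thesis
    proof (cases "i = s - 1")
      case True
      have "?B = 1\<^sub>m (d - 1)"
      proof (rule eq_matI)
        fix r c assume "r < dim_row (1\<^sub>m (d - 1))" "c < dim_col (1\<^sub>m (d - 1))"
        then have rc: "r < d - 1" "c < d - 1" by auto
        then show "?B $$ (r, c) = 1\<^sub>m (d - 1) $$ (r, c)"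
          unfolding entry[OF rc] using s True other[of "if r < i then r else Suc r" c] by auto
      qed (use B in auto)
      moreover have "(- 1 :: complex) ^ (i + (d - 1)) = (- 1) ^ (d - s)"
      proof -
        have "i + (d - 1) = 2 * (s - 1) + (d - s)" using True s by auto
        then show ?thesis by (simp add: power_add power_mult)
      qed
      ultimately show ?thesis using True by (simp add: cofactor_def)
    next
      case False
      \<comment> \<open>\<open>q\<close> is the place of the row of \<open>g s\<close> (index
        \<open>s - 1\<close>) after row \<open>i\<close> is deleted. In the remaining columns this
        row is zero, because \<open>J s\<close> has been omitted.\<close>
      define q where "q = (if s - 1 < i then s - 1 else s - 2)"
      have "q < d - 1" using False s i by (auto simp: q_def)
      moreover have "?B $$ (q, c) = 0" if "c < d - 1" for c
        unfolding entry[OF \<open>q < d - 1\<close> that]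
        using that \<open>q < d - 1\<close> False s i other[of "if q < i then q else Suc q" c]
        by (auto simp: q_def split: if_splits)
      ultimately have "det ?B = 0" using B by (intro det_zero_row) auto
      then show ?thesis using False by (simp add: cofactor_def)
    qed
  qed
  have "det A = (\<Sum>i<d. A $$ (i, d - 1) * cofactor A i (d - 1))"
    using A d by (rule laplace_expansion_column)
  also have "\<dots> = (\<Sum>i<d. if i = s - 1 then coord (g (Suc i)) k * (- 1) ^ (d - s) else 0)"
  proof (rule sum.cong)
    fix i assume "i \<in> {..<d}"
    then have i: "i < d" by simp
    show "A $$ (i, d - 1) * cofactor A i (d - 1) = (if i = s - 1 then coord (g (Suc i)) k * (- 1) ^ (d - s) else 0)"
      unfolding cof[OF i] last[OF i] by simp
  qed simp
  also have "\<dots> = (- 1) ^ (d - s) * coord (g s) k"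
  proof -
    have "s - 1 < d" "Suc (s - 1) = s" using s by auto
    then show ?thesis by (simp add: mult.commute)
  qed
  finally show ?thesis by (simp add: A_def plucker_minor_def)
qed

text \<open>Both sides alternate in \<open>I\<close>, so agreement on increasing tuples suffices;
  the sign of the sorting permutation enters twice and cancels.\<close>

lemma beta_tuple_plucker:
  assumes P: "\<And>I. strict_mono_on {1..d} I \<Longrightarrow> I ` {1..d} \<subseteq> {1..m} \<Longrightarrow>
      beta_E n z E (partition_of d I) = b * plucker_minor d g I"
    and I: "I ` {1..d} \<subseteq> {1..m}"
  shows "beta_tuple n z E d I = b * plucker_minor d g I"
proof (cases "inj_on I {1..d}")
  case True
  define \<sigma> where "\<sigma> = (THE \<sigma>. \<sigma> permutes {1..d} \<and> strict_mono_on {1..d} (I \<circ> \<sigma>))"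
  have \<sigma>: "\<sigma> permutes {1..d}" "strict_mono_on {1..d} (I \<circ> \<sigma>)"
    using theI'[OF sorting_permutation[OF True]] by (auto simp: \<sigma>_def)
  have "(I \<circ> \<sigma>) ` {1..d} \<subseteq> {1..m}"
    using I permutes_image[OF \<sigma>(1)] by (metis image_comp)
  then have "beta_E n z E (partition_of d (I \<circ> \<sigma>)) = b * (of_int (sign \<sigma>) * plucker_minor d g I)"
    using P[OF \<sigma>(2)] by (simp only: plucker_minor_permute[OF \<sigma>(1)])
  moreover have "beta_tuple n z E d I = of_int (sign \<sigma>) * beta_E n z E (partition_of d (I \<circ> \<sigma>))"
    unfolding beta_tuple_def Let_def \<sigma>_def[symmetric] using True by simp
  ultimately have "beta_tuple n z E d I = of_int (sign \<sigma>) * (b * (of_int (sign \<sigma>) * plucker_minor d g I))"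
    by simp
  also have "\<dots> = of_int (sign \<sigma> * sign \<sigma>) * (b * plucker_minor d g I)"
    by (simp only: of_int_mult mult_ac)
  finally show ?thesis by (simp only: sign_idempotent of_int_1 mult_1)
qed (simp add: beta_tuple_def plucker_minor_not_inj)

section \<open>Degrees and coordinates of the members of a Schubert cell\<close>

lemma is_basis_memE:
  assumes "is_basis d h V" and "v \<in> V"
  obtains c where "v = (\<Sum>i = 1..d. smult (c i) (h i))"
proof -
  have "v \<in> cpoly.span (h ` {1..d})" using assms by (simp add: is_basis_def)
  then obtain u where "v = (\<Sum>p\<in>h ` {1..d}. smult (u p) p)"
    using cpoly.span_finite[of "h ` {1..d}"] by auto
  then have "v = (\<Sum>i = 1..d. smult (u (h i)) (h i))"
    using assms(1) by (simp add: is_basis_def sum.reindex)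
  then show ?thesis by (rule that)
qed

lemma is_basis_mem:
  assumes "is_basis d h V" and "i \<in> {1..d}"
  shows "h i \<in> V"
  using assms cpoly.span_base by (fastforce simp: is_basis_def)

text \<open>The degrees \<open>\<nu> i + d - i\<close> strictly decrease in i, so leading terms
  cannot cancel: the least index with nonzero coefficient decides. Reversing the order of indices
  turns its degree into an entry of J.\<close>

lemma schubert_cell_degree:
  assumes part: "is_partition \<nu>" and V: "V \<in> schubert_cell d m \<nu>" and v: "v \<in> V" "v \<noteq> 0"
  obtains s where "s \<in> {1..d}" and "degree v = top_tuple d \<nu> s - 1"
proof -
  obtain h where h: "is_basis d h V" "\<And>i. i \<in> {1..d} \<Longrightarrow> degree (h i) = \<nu> i + d - i"
    using V by (auto simp: schubert_cell_def)
  obtain c where c: "v = (\<Sum>i = 1..d. smult (c i) (h i))"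
    using is_basis_memE[OF h(1) v(1)] by blast
  define S where "S = {i \<in> {1..d}. c i \<noteq> 0}"
  have "S \<noteq> {}" using v(2) c by (force simp: S_def)
  define i where "i = Min S"
  have fin: "finite S" by (simp add: S_def)
  have "i \<in> S" using \<open>S \<noteq> {}\<close> fin by (simp add: i_def)
  then have i: "i \<in> {1..d}" "c i \<noteq> 0" by (simp_all add: S_def)
  have zero: "c k = 0" if "k \<in> {1..d}" "k < i" for k
  proof (rule ccontr)
    assume "c k \<noteq> 0"
    then have "k \<in> S" using that by (simp add: S_def)
    then show False using Min_le[OF fin, of k] that(2) by (simp add: i_def)
  qed
  have deg: "degree (h k) < degree (h i)" if "k \<in> {1..d}" "i < k" for k
    using that i(1) h(2) partition_antimono[OF part, of i k] by auto
  have "h i \<noteq> 0"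
    using h(1) i(1) cpoly.dependent_zero[of "h ` {1..d}"] by (force simp: is_basis_def)
  have "coeff v (degree (h i)) = (\<Sum>k = 1..d. if k = i then c i * lead_coeff (h i) else 0)"
    unfolding c coeff_sum
  proof (rule sum.cong)
    fix k assume k: "k \<in> {1..d}"
    show "coeff (smult (c k) (h k)) (degree (h i)) = (if k = i then c i * lead_coeff (h i) else 0)"
      using zero[OF k] deg[OF k] by (cases k i rule: linorder_cases) (auto simp: coeff_eq_0)
  qed simp
  also have "\<dots> \<noteq> 0" using i \<open>h i \<noteq> 0\<close> by simp
  finally have "degree (h i) \<le> degree v" by (rule le_degree)
  moreover have "degree v \<le> degree (h i)"
    unfolding c
  proof (rule degree_sum_le)
    fix k assume k: "k \<in> {1..d}"
    show "degree (smult (c k) (h k)) \<le> degree (h i)"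
      using zero[OF k] deg[OF k] by (cases k i rule: linorder_cases) (auto intro: less_imp_le)
  qed simp
  ultimately have "degree v = top_tuple d \<nu> (d + 1 - i) - 1"
    using i(1) h(2)[OF i(1)] by (auto simp: top_tuple_def)
  then show ?thesis using i(1) by (intro that[of "d + 1 - i"]) auto
qed

text \<open>The leading term of a nonzero member sits at a position of J. Hence the coordinates at J
  determine a member; both spanning and uniqueness of the reduced basis rest on this.\<close>

lemma schubert_cell_determined:
  assumes "is_partition \<nu>" and "V \<in> schubert_cell d m \<nu>" and "v \<in> V"
    and "\<And>s. s \<in> {1..d} \<Longrightarrow> coord v (top_tuple d \<nu> s) = 0"
  shows "v = 0"
proof (rule ccontr)
  assume "v \<noteq> 0"
  then obtain s where "s \<in> {1..d}" "degree v = top_tuple d \<nu> s - 1"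
    using schubert_cell_degree[OF assms(1-3)] by blast
  then have "coord v (top_tuple d \<nu> s) = fact (degree v) * lead_coeff v"
    by (simp add: coord_def)
  then show False using assms(4)[OF \<open>s \<in> {1..d}\<close>] \<open>v \<noteq> 0\<close> by simp
qed

lemma top_tuple_strict_mono:
  assumes "is_partition \<nu>"
  shows "strict_mono_on {1..d} (top_tuple d \<nu>)"
proof (rule strict_mono_onI)
  fix r s assume "r \<in> {1..d}" "s \<in> {1..d}" "r < s"
  moreover from this have "\<nu> (d + 1 - r) \<le> \<nu> (d + 1 - s)"
    by (intro partition_antimono[OF assms]) auto
  ultimately show "top_tuple d \<nu> r < top_tuple d \<nu> s"
    by (simp add: top_tuple_def)
qed

lemma top_tuple_range:
  assumes "is_partition \<nu>" and "m \<ge> d + \<nu> 1"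
  shows "top_tuple d \<nu> ` {1..d} \<subseteq> {1..m}"
proof
  fix j assume "j \<in> top_tuple d \<nu> ` {1..d}"
  then obtain i where i: "i \<in> {1..d}" "j = top_tuple d \<nu> i" by auto
  then have "\<nu> (d + 1 - i) \<le> \<nu> 1" using partition_antimono[OF assms(1), of 1 "d + 1 - i"] by auto
  then show "j \<in> {1..m}" using i assms(2) by (auto simp: top_tuple_def)
qed

lemma partition_of_top_tuple:
  assumes "is_partition \<nu>" and "\<forall>i>d. \<nu> i = 0"
  shows "partition_of d (top_tuple d \<nu>) = \<nu>"
proof
  fix r
  show "partition_of d (top_tuple d \<nu>) r = \<nu> r"
    using assms by (auto simp: partition_of_def top_tuple_def is_partition_def not_le)
qed

text \<open>Multiply \<open>h\<close> by the inverse of its columns J, which exists as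
  \<open>P \<nu>\<close> is nonzero. All minors are multiplied by \<open>det A\<close>, and the one
  at J becomes 1, so the projective factor becomes \<open>P \<nu>\<close>.\<close>

lemma reduced_basis:
  assumes part: "is_partition \<nu>" and len: "\<forall>i>d. \<nu> i = 0" and m: "m \<ge> d + \<nu> 1"
    and V: "V \<in> schubert_cell d m \<nu>" and P: "has_plucker_coords d m V P" and "P \<nu> \<noteq> 0"
  obtains g where "\<And>i. i \<in> {1..d} \<Longrightarrow> g i \<in> V"
    and "\<And>i j. i \<in> {1..d} \<Longrightarrow> j \<in> {1..d} \<Longrightarrow> coord (g i) (top_tuple d \<nu> j) = (if i = j then 1 else 0)"
    and "\<And>I. strict_mono_on {1..d} I \<Longrightarrow> I ` {1..d} \<subseteq> {1..m} \<Longrightarrow>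
      P (partition_of d I) = P \<nu> * plucker_minor d g I"
proof -
  obtain h c where h: "is_basis d h V" and "c \<noteq> 0" and
    P: "\<And>I. strict_mono_on {1..d} I \<Longrightarrow> I ` {1..d} \<subseteq> {1..m} \<Longrightarrow>
      P (partition_of d I) = c * plucker_minor d h I"
    using P by (auto simp: has_plucker_coords_def)
  let ?J = "top_tuple d \<nu>"
  define H where "H I = mat d d (\<lambda>(r, s). coord (h (Suc r)) (I (Suc s)))" for I
  have H: "H I \<in> carrier_mat d d" for I by (simp add: H_def)
  have minor: "plucker_minor d h I = det (H I)" for I
    by (simp add: plucker_minor_def H_def)
  have PJ: "P \<nu> = c * det (H ?J)"
    using P[OF top_tuple_strict_mono[OF part] top_tuple_range[OF part m]]
    by (simp add: partition_of_top_tuple[OF part len] minor)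
  then have det: "det (H ?J) \<noteq> 0" using \<open>P \<nu> \<noteq> 0\<close> by auto
  define A where "A = (1 / det (H ?J)) \<cdot>\<^sub>m adj_mat (H ?J)"
  have A: "A \<in> carrier_mat d d" unfolding A_def using adj_mat(1)[OF H] by simp
  have AH: "A * H ?J = 1\<^sub>m d"
  proof -
    have "A * H ?J = (1 / det (H ?J)) \<cdot>\<^sub>m (adj_mat (H ?J) * H ?J)"
      unfolding A_def using adj_mat(1)[OF H] H by (rule mult_smult_assoc_mat)
    also have "\<dots> = (1 / det (H ?J)) \<cdot>\<^sub>m (det (H ?J) \<cdot>\<^sub>m 1\<^sub>m d)"
      by (simp only: adj_mat(3)[OF H])
    also have "\<dots> = 1\<^sub>m d"
      using det by (intro eq_matI) auto
    finally show ?thesis .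
  qed
  then have detA: "det A * det (H ?J) = 1"
    using det_mult[OF A H, of ?J] by simp
  define g where "g i = (\<Sum>k<d. smult (A $$ (i - 1, k)) (h (Suc k)))" for i
  have coord_g: "mat d d (\<lambda>(r, s). coord (g (Suc r)) (I (Suc s))) = A * H I" for I
  proof (rule eq_matI)
    fix r s assume "r < dim_row (A * H I)" "s < dim_col (A * H I)"
    then have "r < d" "s < d" using A H[of I] by auto
    then show "mat d d (\<lambda>(r, s). coord (g (Suc r)) (I (Suc s))) $$ (r, s) = (A * H I) $$ (r, s)"
      using A H[of I]
      by (simp add: scalar_prod_def g_def coord_sum coord_smult H_def atLeast0LessThan)
  qed (use A H[of I] in auto)
  show ?thesis
  proof (rule that[of g])
    fix i assume i: "i \<in> {1..d}"
    have "cpoly.subspace V" using V by (simp add: schubert_cell_def Gr_def)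
    then show "g i \<in> V"
      unfolding g_def using is_basis_mem[OF h]
      by (intro cpoly.subspace_sum cpoly.subspace_scale) auto
  next
    fix i j assume ij: "i \<in> {1..d}" "j \<in> {1..d}"
    then have "mat d d (\<lambda>(r, s). coord (g (Suc r)) (?J (Suc s))) $$ (i - 1, j - 1) = 1\<^sub>m d $$ (i - 1, j - 1)"
      by (simp only: coord_g AH)
    then show "coord (g i) (?J j) = (if i = j then 1 else 0)"
      using ij by (auto split: if_splits)
  next
    fix I assume "strict_mono_on {1..d} I" "I ` {1..d} \<subseteq> {1..m}"
    then have "P (partition_of d I) = c * det (H I)"
      using P by (simp add: minor)
    moreover have "plucker_minor d g I = det A * det (H I)"
      unfolding plucker_minor_def coord_g by (rule det_mult[OF A H])
    moreover have "c * det (H ?J) * (det A * det (H I)) = c * det (H I) * (det A * det (H ?J))"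
      by simp
    ultimately show "P (partition_of d I) = P \<nu> * plucker_minor d g I"
      by (simp only: PJ detA mult_1_right)
  qed
qed

lemma dual_is_basis:
  assumes part: "is_partition \<nu>" and V: "V \<in> schubert_cell d m \<nu>"
    and gV: "\<And>i. i \<in> {1..d} \<Longrightarrow> g i \<in> V"
    and dual: "\<And>i j. i \<in> {1..d} \<Longrightarrow> j \<in> {1..d} \<Longrightarrow> coord (g i) (top_tuple d \<nu> j) = (if i = j then 1 else 0)"
  shows "is_basis d g V"
proof -
  have sub: "cpoly.subspace V" using V by (simp add: schubert_cell_def Gr_def)
  have inj: "inj_on g {1..d}"
  proof (rule inj_onI)
    fix i j assume "i \<in> {1..d}" "j \<in> {1..d}" "g i = g j"
    then show "i = j" by (metis dual zero_neq_one)
  qed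
  have comb: "coord (\<Sum>i = 1..d. smult (c i) (g i)) (top_tuple d \<nu> j) = c j" if "j \<in> {1..d}" for c j
  proof -
    have "coord (\<Sum>i = 1..d. smult (c i) (g i)) (top_tuple d \<nu> j) = (\<Sum>i = 1..d. if i = j then c i else 0)"
      unfolding coord_sum coord_smult
    proof (rule sum.cong)
      fix i assume i: "i \<in> {1..d}"
      show "c i * coord (g i) (top_tuple d \<nu> j) = (if i = j then c i else 0)"
        unfolding dual[OF i that] by simp
    qed simp
    then show ?thesis using that by simp
  qed
  have "cpoly.independent (g ` {1..d})"
  proof
    assume "cpoly.dependent (g ` {1..d})"
    then obtain u where u: "\<exists>p\<in>g ` {1..d}. u p \<noteq> 0" "(\<Sum>p\<in>g ` {1..d}. smult (u p) p) = 0"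
      using cpoly.dependent_finite[of "g ` {1..d}"] by auto
    then have "(\<Sum>i = 1..d. smult (u (g i)) (g i)) = 0"
      using inj by (simp add: sum.reindex)
    then have "u (g j) = 0" if "j \<in> {1..d}" for j
      using comb[OF that, of "\<lambda>i. u (g i)"] by (simp add: coord_def)
    then show False using u(1) by auto
  qed
  moreover have "cpoly.span (g ` {1..d}) \<subseteq> V"
    using gV sub by (intro cpoly.span_minimal) auto
  moreover have "v \<in> cpoly.span (g ` {1..d})" if v: "v \<in> V" for v
  proof -
    \<comment> \<open>By \<open>comb\<close>, \<open>w\<close> matches \<open>v\<close> at every
      position of J, so their difference vanishes.\<close>
    define w where "w = (\<Sum>i = 1..d. smult (coord v (top_tuple d \<nu> i)) (g i))"
    have w: "w \<in> cpoly.span (g ` {1..d})"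
      unfolding w_def by (intro cpoly.span_sum cpoly.span_scale cpoly.span_base) auto
    then have "v - w \<in> V"
      using calculation(2) sub v by (intro cpoly.subspace_diff) auto
    moreover have "coord (v - w) (top_tuple d \<nu> j) = 0" if "j \<in> {1..d}" for j
      using comb[OF that] by (simp add: coord_diff w_def)
    ultimately have "v - w = 0"
      using schubert_cell_determined[OF part V] by blast
    then show ?thesis using w by simp
  qed
  ultimately show ?thesis using inj by (auto simp: is_basis_def)
qed

theorem theorem5p8:
  fixes n d m :: nat
    and z :: "nat \<Rightarrow> complex"
    and \<nu> :: "nat \<Rightarrow> nat"
    and E :: "((nat \<Rightarrow> nat set) \<Rightarrow> complex) set"
    and V :: "complex poly set"
  assumes "is_partition \<nu>" and "psize \<nu> = n" and "\<forall>i>d. \<nu> i = 0" and "m \<ge> d + \<nu> 1"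
    and "is_eigenspace (specht {1..n} \<nu>) (bethe_image n z \<nu>) E"
    and "V \<in> schubert_cell d m \<nu>" and "has_plucker_coords d m V (beta_E n z E)"
  shows "is_basis d (f_poly n z \<nu> E d) V \<and>
         is_reduced d (top_tuple d \<nu>) (f_poly n z \<nu> E d) \<and>
         (\<forall>h. is_basis d h V \<and> is_reduced d (top_tuple d \<nu>) h \<longrightarrow>
              (\<forall>i\<in>{1..d}. h i = f_poly n z \<nu> E d i))"
proof -
  note part = assms(1) and V = assms(6)
  let ?J = "top_tuple d \<nu>" and ?f = "f_poly n z \<nu> E d"
  define b where "b = beta_E n z E \<nu>"
  have b: "of_nat (num_SYT \<nu>) / fact n * b = 1" "b \<noteq> 0"
    using beta_scalar[OF assms(1,2,5)] by (simp_all add: b_def)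
  obtain g where gV: "\<And>i. i \<in> {1..d} \<Longrightarrow> g i \<in> V"
    and dual: "\<And>i j. i \<in> {1..d} \<Longrightarrow> j \<in> {1..d} \<Longrightarrow> coord (g i) (?J j) = (if i = j then 1 else 0)"
    and P: "\<And>I. strict_mono_on {1..d} I \<Longrightarrow> I ` {1..d} \<subseteq> {1..m} \<Longrightarrow>
      beta_E n z E (partition_of d I) = b * plucker_minor d g I"
    using reduced_basis[OF assms(1,3,4,6,7)] b(2) unfolding b_def by blast
  have J_pos: "?J i \<ge> 1" if "i \<in> {1..d}" for i
    using that by (auto simp: top_tuple_def)
  have J_inj: "?J i = ?J j \<longleftrightarrow> i = j" if "i \<in> {1..d}" "j \<in> {1..d}" for i j
    using strict_mono_on_imp_inj_on[OF top_tuple_strict_mono[OF part]] that by (rule inj_on_eq_iff)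
  \<comment> \<open>The degree is some \<open>?J s - 1\<close>, and the coordinate at
    \<open>?J s\<close> is then nonzero; duality leaves only s = i.\<close>
  have deg: "degree (g i) = ?J i - 1" if i: "i \<in> {1..d}" for i
  proof -
    have "g i \<noteq> 0" using dual[OF i i] by (auto simp: coord_def)
    then obtain s where s: "s \<in> {1..d}" "degree (g i) = ?J s - 1"
      using schubert_cell_degree[OF part V gV[OF i]] by blast
    have "coeff (g i) (?J s - 1) \<noteq> 0"
      unfolding s(2)[symmetric] using \<open>g i \<noteq> 0\<close> by simp
    then have "coord (g i) (?J s) \<noteq> 0" by (simp add: coord_def)
    then show ?thesis using dual[OF i s(1)] s(2) by (auto split: if_splits)
  qed
  have replace: "beta_replace n z E d ?J i k = b * coord (g i) k" if i: "i \<in> {1..d}" and k: "k \<in> {1..m}" for i k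
  proof -
    have "replace_last d ?J i k r \<in> {1..m}" if "r \<in> {1..d}" for r
      using that k i top_tuple_range[OF part assms(4)]
      by (auto simp: replace_last_def image_subset_iff)
    then have "replace_last d ?J i k ` {1..d} \<subseteq> {1..m}" by blast
    with P have "beta_tuple n z E d (replace_last d ?J i k) = b * plucker_minor d g (replace_last d ?J i k)"
      by (rule beta_tuple_plucker)
    then have "beta_tuple n z E d (replace_last d ?J i k) = b * ((- 1) ^ (d - i) * coord (g i) k)"
      by (simp only: plucker_minor_replace_last[OF i dual])
    \<comment> \<open>The sign in \<open>beta_replace\<close> meets the equal sign from the
      expansion of the minor.\<close>
    then have "beta_replace n z E d ?J i k = ((- 1) ^ (d - i) * (- 1) ^ (d - i)) * (b * coord (g i) k)"
      by (simp add: beta_replace_def)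
    then show ?thesis by (simp add: power_mult_distrib[symmetric])
  qed
  have fg: "?f i = g i" if i: "i \<in> {1..d}" for i
  proof (rule poly_eqI)
    fix k
    have "coeff (?f i) k = of_nat (num_SYT \<nu>) / fact n *
        (\<Sum>l = 1..?J i. if l = Suc k then beta_replace n z E d ?J i l / fact (l - 1) else 0)"
      unfolding f_poly_def coeff_smult coeff_sum
      by (intro arg_cong2[where f = "(*)"] sum.cong refl) (auto simp: coeff_monom)
    also have "\<dots> = coeff (g i) k"
    proof (cases "Suc k \<le> ?J i")
      case True
      have "Suc k \<in> {1..m}"
        using True top_tuple_range[OF part assms(4)] i by (force simp: image_subset_iff)
      then have "beta_replace n z E d ?J i (Suc k) / fact k = b * coeff (g i) k"
        using replace[OF i] by (simp add: coord_def)
      then show ?thesis using True b(1) by (simp add: mult.assoc[symmetric])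
    next
      case False
      \<comment> \<open>Here the sum in \<open>f_poly\<close> has already ended, and
        \<open>k\<close> exceeds the degree of \<open>g i\<close>.\<close>
      then have "coeff (g i) k = 0" using deg[OF i] J_pos[OF i] by (intro coeff_eq_0) simp
      then show ?thesis using False by simp
    qed
    finally show "coeff (?f i) k = coeff (g i) k" .
  qed
  have coeff: "coeff p (?J j - 1) = coord p (?J j) / fact (?J j - 1)" for p j
    by (simp add: coord_def)
  have basis: "is_basis d ?f V"
    using dual_is_basis[OF part V] gV dual fg by simp
  moreover have "is_reduced d ?J ?f"
    unfolding is_reduced_def
  proof (intro ballI conjI)
    fix i assume i: "i \<in> {1..d}"
    show "degree (?f i) = ?J i - 1" by (simp add: fg[OF i] deg[OF i])
    show "lead_coeff (?f i) = 1 / fact (?J i - 1)"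
      unfolding fg[OF i] deg[OF i] coeff[of "g i" i] dual[OF i i] by simp
    fix k assume "k \<in> ?J ` {1..d} - {?J i}"
    then obtain j where j: "j \<in> {1..d}" "k = ?J j" "j \<noteq> i" by blast
    show "coeff (?f i) (k - 1) = 0"
      unfolding fg[OF i] j(2) coeff[of "g i" j] dual[OF i j(1)] using j(3) by simp
  qed
  moreover have "h i = ?f i" if h: "is_basis d h V" "is_reduced d ?J h" and i: "i \<in> {1..d}" for h i
  proof -
    have sub: "cpoly.subspace V" using V by (simp add: schubert_cell_def Gr_def)
    \<comment> \<open>In the normalised coordinates, being reduced implies duality to the positions
      J, so \<open>h i\<close> agrees with \<open>g i\<close> there.\<close>
    have "coord (h i) (?J j) = (if i = j then 1 else 0)" if j: "j \<in> {1..d}" for j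
    proof (cases "i = j")
      case True
      have "degree (h i) = ?J i - 1" "lead_coeff (h i) = 1 / fact (?J i - 1)"
        using h(2) i unfolding is_reduced_def by blast+
      then have "coeff (h i) (?J i - 1) = 1 / fact (?J i - 1)"
        by (simp only:)
      then show ?thesis using True by (simp add: coord_def)
    next
      case False
      then have "coeff (h i) (?J j - 1) = 0"
        using h(2) i j J_inj[OF i j] by (auto simp: is_reduced_def)
      then show ?thesis using False by (simp add: coord_def)
    qed
    then have "coord (h i - g i) (?J j) = 0" if "j \<in> {1..d}" for j
      using that dual[OF i that] by (simp add: coord_diff)
    moreover have "h i - g i \<in> V"
      using sub is_basis_mem[OF h(1) i] gV[OF i] by (rule cpoly.subspace_diff)
    ultimately have "h i - g i = 0"
      using schubert_cell_determined[OF part V] by blast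
    then show ?thesis by (simp add: fg[OF i])
  qed
  ultimately show ?thesis by blast
qed

end
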